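(* Let $s\in\mathbb{C}$. There is no solution $h$ of $\{h,\tau\}=sE_4(\tau)$ on $\mathfrak{H}$ such that the associated representation $\rho$ is reducible and $\ker\rho$ has finite index in $\mathrm{SL}_2(\mathbb{Z})$.
   Context: $\{h,\tau\}=\frac{h'''}{h'}-\frac32(\frac{h''}{h'})^2$ is the Schwarz derivative, $E_4=1+240\sum_{k\ge1}\sigma_3(k)e^{2\pi ik\tau}$. For any such solution $h$ there is a homomorphism $\rho:\mathrm{SL}_2(\mathbb{Z})\to\mathrm{PGL}_2(\mathbb{C})$ with $h(\gamma\tau)=\rho(\gamma)h(\tau)$ for all $\gamma\in\mathrm{SL}_2(\mathbb{Z})$, $\tau\in\mathfrak{H}$, both sides acting by linear fractional transformations; this is the associated representation, and $\ker\rho=\{\gamma: h(\gamma\tau)=h(\tau)\ \forall\tau\}$. $\rho$ is reducible if the transformations $\rho(\gamma)$ have a common fixed point in $\mathbb{P}^1(\mathbb{C})$ (equivalently, after conjugation by a constant matrix, all $\rho(\gamma)$ are upper triangular). *)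

theory Defs
  imports "HOL-Complex_Analysis.Complex_Analysis" "HOL-Algebra.Coset"
begin

(* clashes with the component syntax of vectors *)
no_notation fps_nth (infixl \<open>$\<close> 75)

section \<open>The modular group, $PGL_2(C)$ and linear fractional transformations\<close>

definition SL2Z :: "(int^2^2) monoid" where
  "SL2Z = \<lparr>carrier = {A. det A = 1}, mult = (**), one = mat 1\<rparr>"

definition GL2C :: "(complex^2^2) monoid" where
  "GL2C = \<lparr>carrier = {A. invertible A}, mult = (**), one = mat 1\<rparr>"

definition scalars2C :: "(complex^2^2) set" where
  "scalars2C = {mat c | c. c \<noteq> 0}"

definition PGL2C :: "(complex^2^2) set monoid" where
  "PGL2C = GL2C Mod scalars2C"

text \<open>The projective line over the complex numbers is \<^typ>\<open>complex option\<close>, with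
  \<^term>\<open>None\<close> as the point at infinity.\<close>

type_synonym P1C = "complex option"

definition lft :: "complex^2^2 \<Rightarrow> P1C \<Rightarrow> P1C" where
  "lft A p = (case p of
      None \<Rightarrow> if A$2$1 = 0 then None else Some (A$1$1 / A$2$1)
    | Some z \<Rightarrow> if A$2$1 * z + A$2$2 = 0 then None
               else Some ((A$1$1 * z + A$1$2) / (A$2$1 * z + A$2$2)))"

text \<open>All representatives of an element of \<^const>\<open>PGL2C\<close> induce the same transformation;
  see \<open>pgl_act_coset\<close> below.\<close>

definition pgl_act :: "(complex^2^2) set \<Rightarrow> P1C \<Rightarrow> P1C" where
  "pgl_act C p = the_elem ((\<lambda>A. lft A p) ` C)"

definition upper_half_plane :: "complex set" where
  "upper_half_plane = {\<tau>. Im \<tau> > 0}"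

definition sl2z_act :: "int^2^2 \<Rightarrow> complex \<Rightarrow> complex" where
  "sl2z_act \<gamma> \<tau> =
     (of_int (\<gamma>$1$1) * \<tau> + of_int (\<gamma>$1$2)) / (of_int (\<gamma>$2$1) * \<tau> + of_int (\<gamma>$2$2))"

lemma group_SL2Z: "group SL2Z"
proof (rule groupI)
  fix A :: "int^2^2" assume "A \<in> carrier SL2Z"
  then have d: "A$1$1 * A$2$2 - A$1$2 * A$2$1 = 1"
    by (simp add: SL2Z_def det_2)
  define B :: "int^2^2" where "B = vector [vector [A$2$2, - A$1$2], vector [- A$2$1, A$1$1]]"
  have "det B = 1" "B ** A = mat 1"
    using d by (auto simp: B_def det_2 vec_eq_iff forall_2 matrix_matrix_mult_def mat_def
        sum_2 algebra_simps)
  then show "\<exists>B\<in>carrier SL2Z. B \<otimes>\<^bsub>SL2Z\<^esub> A = \<one>\<^bsub>SL2Z\<^esub>"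
    by (auto simp: SL2Z_def)
qed (auto simp: SL2Z_def det_mul matrix_mul_assoc)

lemma group_GL2C: "group GL2C"
proof (rule groupI)
  fix A :: "complex^2^2" assume "A \<in> carrier GL2C"
  then obtain B where "A ** B = mat 1" "B ** A = mat 1"
    by (auto simp: GL2C_def invertible_def)
  then show "\<exists>B\<in>carrier GL2C. B \<otimes>\<^bsub>GL2C\<^esub> A = \<one>\<^bsub>GL2C\<^esub>"
    by (auto simp: GL2C_def invertible_def)
qed (simp_all add: GL2C_def invertible_mult matrix_mul_assoc,
     auto simp: invertible_def intro: exI[of _ "mat 1"])

lemma mat_mult_2: "mat c ** (A :: complex^2^2) = (\<chi> i j. c * A$i$j)"
  "(A :: complex^2^2) ** mat c = (\<chi> i j. c * A$i$j)"
  by (auto simp: vec_eq_iff forall_2 matrix_matrix_mult_def mat_def sum_2)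

lemma mat_invertible_2: "c \<noteq> 0 \<Longrightarrow> invertible (mat c :: complex^2^2)"
  by (simp add: invertible_det_nz det_2 mat_def)

lemma normal_scalars2C: "scalars2C \<lhd> GL2C"
proof -
  interpret group GL2C by (rule group_GL2C)
  have mm: "mat c ** mat d = (mat (c * d) :: complex^2^2)" for c d
    by (simp add: vec_eq_iff forall_2 matrix_matrix_mult_def sum_2 mat_def)
  have "subgroup scalars2C GL2C"
  proof (rule subgroupI)
    fix A assume "A \<in> scalars2C"
    then obtain c where c: "A = mat c" "c \<noteq> 0" by (auto simp: scalars2C_def)
    have "inv\<^bsub>GL2C\<^esub> A = mat (inverse c)"
      using c by (intro inv_equality) (auto simp: GL2C_def mm mat_invertible_2)
    then show "inv\<^bsub>GL2C\<^esub> A \<in> scalars2C"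
      using c by (auto simp: scalars2C_def)
  next
    show "scalars2C \<subseteq> carrier GL2C" "scalars2C \<noteq> {}"
      by (auto simp: scalars2C_def GL2C_def mat_invertible_2 intro: exI[of _ 1])
  next
    fix A B assume "A \<in> scalars2C" "B \<in> scalars2C"
    then show "A \<otimes>\<^bsub>GL2C\<^esub> B \<in> scalars2C"
      by (auto simp: scalars2C_def GL2C_def mm)
  qed
  then show ?thesis
    by (rule normalI) (auto simp: r_coset_def l_coset_def scalars2C_def GL2C_def mat_mult_2)
qed

lemma group_PGL2C: "group PGL2C"
  unfolding PGL2C_def by (rule normal.factorgroup_is_group[OF normal_scalars2C])

lemma lft_mat_mult: "c \<noteq> 0 \<Longrightarrow> lft (mat c ** A) p = lft A p"
proof -
  assume c: "c \<noteq> 0"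
  have 1: "c * x * z + c * y = c * (x * z + y)" for x y z
    by (simp add: algebra_simps)
  show ?thesis
    using c by (auto simp: lft_def mat_mult_2 1 split: option.splits)
qed

lemma pgl_act_coset: "pgl_act (scalars2C #>\<^bsub>GL2C\<^esub> A) p = lft A p"
proof -
  have "scalars2C #>\<^bsub>GL2C\<^esub> A = (\<lambda>c. mat c ** A) ` (- {0})"
    by (auto simp: r_coset_def scalars2C_def GL2C_def)
  moreover have "(\<lambda>c. lft (mat c ** A) p) ` (- {0}) = (\<lambda>_. lft A p) ` (- {0 :: complex})"
    by (intro image_cong) (auto simp: lft_mat_mult)
  moreover have "\<dots> = {lft A p}"
    by (auto intro: image_eqI[of _ _ 1])
  ultimately have "(\<lambda>B. lft B p) ` (scalars2C #>\<^bsub>GL2C\<^esub> A) = {lft A p}"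
    by (simp add: image_image)
  then show ?thesis by (simp add: pgl_act_def)
qed

lemma lft_mult:
  assumes "invertible A" "invertible B"
  shows "lft (A ** B) p = lft A (lft B p)"
proof -
  note m = matrix_matrix_mult_def sum_2
  have dB: "B$1$1 * B$2$2 - B$1$2 * B$2$1 \<noteq> 0"
    using assms by (simp add: invertible_det_nz det_2)
  have frac: "lft A (Some (x / y)) = (if A$2$1 * x + A$2$2 * y = 0 then None
      else Some ((A$1$1 * x + A$1$2 * y) / (A$2$1 * x + A$2$2 * y)))" if "y \<noteq> 0" for x y
  proof -
    have "A$i$1 * (x / y) + A$i$2 = (A$i$1 * x + A$i$2 * y) / y" for i
      using that by (simp add: field_simps)
    with that show ?thesis by (simp add: lft_def)
  qed
  show ?thesis
  proof (cases p)
    case None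
    with dB show ?thesis
      by (cases "B$2$1 = 0") (simp_all add: lft_def[of _ None] frac m)
  next
    case (Some z)
    define u where "u = B$1$1 * z + B$1$2"
    define v where "v = B$2$1 * z + B$2$2"
    have "(A**B)$i$1 * z + (A**B)$i$2 = A$i$1 * u + A$i$2 * v" for i
      by (simp add: m u_def v_def algebra_simps)
    then have AB: "lft (A ** B) p = (if A$2$1 * u + A$2$2 * v = 0 then None
        else Some ((A$1$1 * u + A$1$2 * v) / (A$2$1 * u + A$2$2 * v)))"
      by (simp add: Some lft_def)
    have B: "lft B p = (if v = 0 then None else Some (u / v))"
      by (simp add: Some lft_def u_def v_def)
    have "B$1$1 * v - B$2$1 * u = B$1$1 * B$2$2 - B$1$2 * B$2$1"
      by (simp add: u_def v_def algebra_simps)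
    with dB have "u \<noteq> 0" if "v = 0"
      using that by auto
    then show ?thesis
      by (cases "v = 0") (simp_all add: AB B frac lft_def[of A None])
  qed
qed

section \<open>The Schwarzian equation\<close>

definition schwarzian :: "(complex \<Rightarrow> complex) \<Rightarrow> complex \<Rightarrow> complex" where
  "schwarzian h \<tau> = (deriv ^^ 3) h \<tau> / deriv h \<tau> - 3/2 * ((deriv ^^ 2) h \<tau> / deriv h \<tau>)\<^sup>2"

definition sigma3 :: "nat \<Rightarrow> nat" where
  "sigma3 k = (\<Sum>d | d dvd k. d ^ 3)"

definition E4 :: "complex \<Rightarrow> complex" where
  "E4 \<tau> = 1 + 240 * (\<Sum>k. of_nat (sigma3 (Suc k)) * exp (2 * of_real pi * \<i> * of_nat (Suc k) * \<tau>))"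

text \<open>Solutions are non-constant meromorphic functions on the upper half-plane.  The equation is
  an identity of meromorphic functions, so it is imposed where its left-hand side is
  literally defined: off the poles of \<open>h\<close> and the zeros of \<open>h'\<close>.  Constants must be excluded
  explicitly, since \<open>h'\<close> appears as a denominator.  In \<open>nicely_meromorphic_on\<close>,
  removable singularities are filled in, so that \<open>h\<close> has its genuine value off its poles.\<close>

definition schwarzian_solution :: "complex \<Rightarrow> (complex \<Rightarrow> complex) \<Rightarrow> bool" where
  "schwarzian_solution s h \<longleftrightarrow>
     h nicely_meromorphic_on upper_half_plane \<and>
     \<not> h constant_on upper_half_plane \<and>
     (\<forall>\<tau>\<in>upper_half_plane. \<not> is_pole h \<tau> \<and> deriv h \<tau> \<noteq> 0 \<longrightarrow> schwarzian h \<tau> = s * E4 \<tau>)"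

definition P1_value :: "(complex \<Rightarrow> complex) \<Rightarrow> complex \<Rightarrow> P1C" where
  "P1_value h \<tau> = (if is_pole h \<tau> then None else Some (h \<tau>))"

definition associated_representation ::
    "(complex \<Rightarrow> complex) \<Rightarrow> (int^2^2 \<Rightarrow> (complex^2^2) set) \<Rightarrow> bool" where
  "associated_representation h \<rho> \<longleftrightarrow>
     \<rho> \<in> hom SL2Z PGL2C \<and>
     (\<forall>\<gamma>\<in>carrier SL2Z. \<forall>\<tau>\<in>upper_half_plane.
        P1_value h (sl2z_act \<gamma> \<tau>) = pgl_act (\<rho> \<gamma>) (P1_value h \<tau>))"

definition reducible_representation :: "(int^2^2 \<Rightarrow> (complex^2^2) set) \<Rightarrow> bool" where
  "reducible_representation \<rho> \<longleftrightarrow> (\<exists>p. \<forall>\<gamma>\<in>carrier SL2Z. pgl_act (\<rho> \<gamma>) p = p)"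

definition finite_index :: "'a set \<Rightarrow> ('a, 'b) monoid_scheme \<Rightarrow> bool" where
  "finite_index H G \<longleftrightarrow> subgroup H G \<and> finite (rcosets\<^bsub>G\<^esub> H)"

end

theory Submission
  imports Defs "HOL-Real_Asymp.Real_Asymp"
begin

text \<open>
  A finite group of Moebius transformations with a fixed point has a second one, so after a
  Moebius change of variable \<open>f = (ah + b) / (ch + d)\<close> is semi-invariant:
  \<open>f (\<gamma> \<tau>) = \<alpha> \<gamma> * f \<tau>\<close> for a character \<open>\<alpha>\<close>. The function \<open>g = f / f'\<close> then has weight \<open>-2\<close>, and
  the Schwarzian equation becomes \<open>2gg'' - g'\<^sup>2 + 2sE\<^sub>4g\<^sup>2 = -1\<close>, which forces \<open>g\<close> to be holomorphic
  on the upper half-plane and, being equivalent to a linear equation with coefficients bounded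
  at the cusp, to be meromorphic at the cusp.

  If \<open>g\<close> is bounded at the cusp, then \<open>g = 0\<close> by the maximum principle, which contradicts the
  equation. If \<open>g\<close> has a pole at the cusp, then \<open>f' / f\<close> tends to \<open>0\<close> there, so \<open>\<alpha> T = 1\<close> and thus
  \<open>\<alpha> S = 1\<close>. But weight \<open>-2\<close> gives \<open>g \<i> = 0\<close>, the equation gives \<open>g' \<i> = \<plusminus>1\<close>, so \<open>f\<close> has order \<open>\<plusminus>1\<close> at the
  elliptic point \<open>\<i>\<close>, and \<open>\<alpha> S = -1\<close>.
\<close>

section \<open>The Eisenstein series\<close>

text \<open>There are at most \<open>k\<close> divisors, each with cube at most
  \<open>k ^ 3\<close>. Polynomial growth is all that convergence of the series needs.\<close>

lemma sigma3_le: "sigma3 k \<le> k ^ 4"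
proof (cases "k = 0")
  case True
  \<comment> \<open>Every number divides 0, and a sum over an infinite set is 0 by
    convention.\<close>
  then show ?thesis by (simp add: sigma3_def)
next
  case False
  then have fin: "finite {d. d dvd k}" and sub: "{d. d dvd k} \<subseteq> {1..k}"
    by (auto dest: dvd_imp_le intro: Nat.gr0I simp: Suc_le_eq)
  have "sigma3 k \<le> (\<Sum>d\<in>{1..k}. d ^ 3)"
    unfolding sigma3_def by (rule sum_mono2) (use sub in auto)
  also have "\<dots> \<le> (\<Sum>d\<in>{1..k}. k ^ 3)"
    by (intro sum_mono power_mono) auto
  also have "\<dots> = k ^ 4" by (simp add: numeral_eq_Suc)
  finally show ?thesis .
qed

lemma summable_sigma3_powser:
  fixes q :: complex
  assumes "norm q < 1"
  shows "summable (\<lambda>k. of_nat (sigma3 (Suc k)) * q ^ k)"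
proof -
  \<comment> \<open>Taking midpoints leaves room twice: \<open>r\<close> stays positive even for
    \<open>q = 0\<close>, and the gap between \<open>r\<close> and \<open>t\<close> absorbs the
    polynomial factor.\<close>
  define r where "r = (norm q + 1) / 2"
  define t where "t = (r + 1) / 2"
  have r: "0 < r" "norm q \<le> r" "r < t" "t < 1" "0 < t" using assms by (auto simp: r_def t_def intro: add_nonneg_pos)
  have "(\<lambda>k. real (Suc k) ^ 4 * r ^ k) \<in> O(\<lambda>k. t ^ k)"
    using r by real_asymp
  moreover have "summable (\<lambda>k. norm (t ^ k))"
    using r by (simp add: norm_power summable_geometric)
  ultimately have s: "summable (\<lambda>k. real (Suc k) ^ 4 * r ^ k)"
    by (rule summable_comparison_test_bigo[rotated])
  show ?thesis
  proof (rule summable_comparison_test'[OF s, of 0])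
    fix k :: nat
    have "real (sigma3 (Suc k)) \<le> real (Suc k) ^ 4"
      using sigma3_le[of "Suc k"] by (metis of_nat_le_iff of_nat_power)
    then show "norm (of_nat (sigma3 (Suc k)) * q ^ k) \<le> real (Suc k) ^ 4 * r ^ k"
      unfolding norm_mult norm_power norm_of_nat using r
      by (intro mult_mono power_mono) auto
  qed
qed

text \<open>Passing to the variable q = exp(2 pi i \<tau>) turns holomorphy of \<open>E4\<close> and
  its boundedness towards the cusp into facts about one holomorphic function on the unit disc. One
  factor q is split off because the series starts at exponent 1.\<close>

lemma E4_eq_powser:
  obtains F where "F holomorphic_on ball 0 1"
    "\<And>\<tau>. \<tau> \<in> upper_half_plane \<Longrightarrow> E4 \<tau> = F (exp (2 * of_real pi * \<i> * \<tau>))"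
proof
  let ?P = "\<lambda>q::complex. \<Sum>k. of_nat (sigma3 (Suc k)) * q ^ k"
  have "?P holomorphic_on ball 0 1"
    using summable_sigma3_powser by (intro power_series_holomorphic[of 0 1 "\<lambda>k. of_nat (sigma3 (Suc k))"])
      (auto intro: summable_sums)
  then show "(\<lambda>q. 1 + 240 * (q * ?P q)) holomorphic_on ball 0 1"
    by (intro holomorphic_intros)
  fix \<tau> assume \<tau>: "\<tau> \<in> upper_half_plane"
  let ?q = "exp (2 * of_real pi * \<i> * \<tau>)"
  have "norm ?q < 1" using \<tau> by (simp add: upper_half_plane_def)
  then have "?q * ?P ?q = (\<Sum>k. ?q * (of_nat (sigma3 (Suc k)) * ?q ^ k))"
    by (intro suminf_mult[symmetric] summable_sigma3_powser)
  also have "(\<lambda>k. ?q * (of_nat (sigma3 (Suc k)) * ?q ^ k)) =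
    (\<lambda>k. of_nat (sigma3 (Suc k)) * exp (2 * of_real pi * \<i> * of_nat (Suc k) * \<tau>))"
  proof
    fix k
    have "exp (2 * of_real pi * \<i> * of_nat (Suc k) * \<tau>) = ?q ^ Suc k"
      by (subst exp_of_nat_mult[symmetric]) (simp add: mult_ac)
    then show "?q * (of_nat (sigma3 (Suc k)) * ?q ^ k) =
       of_nat (sigma3 (Suc k)) * exp (2 * of_real pi * \<i> * of_nat (Suc k) * \<tau>)"
      by simp
  qed
  finally show "E4 \<tau> = 1 + 240 * (?q * ?P ?q)" by (simp add: E4_def)
qed

lemma open_upper_half_plane: "open upper_half_plane"
  unfolding upper_half_plane_def by (rule open_halfspace_Im_gt)

lemma convex_upper_half_plane: "convex upper_half_plane"
  unfolding upper_half_plane_def by (rule convex_halfspace_Im_gt)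

lemma connected_upper_half_plane: "connected upper_half_plane"
  by (intro convex_connected convex_upper_half_plane)

lemma holomorphic_on_E4: "E4 holomorphic_on upper_half_plane"
proof -
  obtain F where F: "F holomorphic_on ball 0 1"
    "\<And>\<tau>. \<tau> \<in> upper_half_plane \<Longrightarrow> E4 \<tau> = F (exp (2 * of_real pi * \<i> * \<tau>))"
    using E4_eq_powser by blast
  have "(F \<circ> (\<lambda>\<tau>. exp (2 * of_real pi * \<i> * \<tau>))) holomorphic_on upper_half_plane"
    by (rule holomorphic_on_compose_gen[OF _ F(1)])
      (auto intro!: holomorphic_intros simp: upper_half_plane_def)
  then show ?thesis using F(2) by (simp cong: holomorphic_cong)
qed

text \<open>The half-plane \<open>Im \<tau> \<ge> 1\<close> is mapped by q into the closed disc of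
  radius exp(-2 pi), a compact part of the unit disc.\<close>

lemma E4_bounded: "\<exists>B. \<forall>\<tau>. Im \<tau> \<ge> 1 \<longrightarrow> norm (E4 \<tau>) \<le> B"
proof -
  obtain F where F: "F holomorphic_on ball 0 1"
    "\<And>\<tau>. \<tau> \<in> upper_half_plane \<Longrightarrow> E4 \<tau> = F (exp (2 * of_real pi * \<i> * \<tau>))"
    using E4_eq_powser by blast
  have "continuous_on (cball 0 (exp (- 2 * pi))) F"
    using holomorphic_on_imp_continuous_on[OF F(1)]
    by (rule continuous_on_subset) (simp add: cball_subset_ball_iff)
  then have "compact (F ` cball 0 (exp (- 2 * pi)))"
    by (rule compact_continuous_image) simp
  then obtain B where B: "\<And>x. x \<in> cball 0 (exp (- 2 * pi)) \<Longrightarrow> norm (F x) \<le> B"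
    by (meson compact_imp_bounded bounded_iff image_eqI)
  show ?thesis
  proof (intro exI allI impI)
    fix \<tau> assume "Im \<tau> \<ge> 1"
    then show "norm (E4 \<tau>) \<le> B"
      using F(2)[of \<tau>] B[of "exp (2 * of_real pi * \<i> * \<tau>)"]
      by (simp add: upper_half_plane_def)
  qed
qed

section \<open>Behaviour at the cusp\<close>

lemma periodic_upper_half_plane_int:
  fixes g :: "complex \<Rightarrow> 'a"
  assumes T: "\<And>\<tau>. Im \<tau> > 0 \<Longrightarrow> g (\<tau> + 1) = g \<tau>" and \<tau>: "Im \<tau> > 0"
  shows "g (\<tau> + of_int n) = g \<tau>"
proof -
  have Tn: "g (\<tau> + of_nat n) = g \<tau>" if "Im \<tau> > 0" for n \<tau>
  proof (induction n)
    case (Suc n)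
    then show ?case using T[of "\<tau> + of_nat n"] that by (simp add: add_ac)
  qed simp
  show ?thesis
    using Tn[of \<tau> "nat n"] Tn[of "\<tau> + of_int n" "nat (- n)"] \<tau> by (cases "n \<ge> 0") auto
qed

text \<open>The principal logarithm jumps across the negative axis, but only by multiples of 2 pi i,
  which periodicity of \<open>g\<close> does not see. So near each point any branch computes the
  same function.\<close>

lemma q_expansion:
  assumes hol: "g holomorphic_on {\<tau>. Im \<tau> > 0}"
    and T: "\<And>\<tau>. Im \<tau> > 0 \<Longrightarrow> g (\<tau> + 1) = g \<tau>"
  obtains G where "G holomorphic_on ball 0 1 - {0}"
    "\<And>\<tau>. Im \<tau> > 0 \<Longrightarrow> G (exp (2 * pi * \<i> * \<tau>)) = g \<tau>"
proof
  define G where "G = (\<lambda>q. g (Ln q / (2 * pi * \<i>)))"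
  show eq: "G (exp (2 * pi * \<i> * \<tau>)) = g \<tau>" if \<tau>: "Im \<tau> > 0" for \<tau>
  proof -
    have "exp (Ln (exp (2 * pi * \<i> * \<tau>))) = exp (2 * pi * \<i> * \<tau>)" by simp
    then obtain n :: int where n: "Ln (exp (2 * pi * \<i> * \<tau>)) = 2 * pi * \<i> * \<tau> + (of_int (2 * n) * pi) * \<i>"
      unfolding exp_eq by blast
    have "Ln (exp (2 * pi * \<i> * \<tau>)) / (2 * pi * \<i>) = \<tau> + of_int n"
      unfolding n by (simp add: field_simps)
    then show ?thesis using periodic_upper_half_plane_int[of g, OF T \<tau>] by (simp add: G_def)
  qed
  show "G holomorphic_on ball 0 1 - {0}"
    unfolding holomorphic_on_open[OF open_Diff[OF open_ball closed_singleton]]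
  proof
    fix q0 :: complex assume q0: "q0 \<in> ball 0 1 - {0}"
    \<comment> \<open>On the half-plane around \<open>q0\<close> the quotient \<open>q / q0\<close>
      avoids the cut, so \<open>\<tau>\<close> is a holomorphic branch of the logarithm there, also
      when \<open>q0\<close> itself lies on the cut.\<close>
    define V where "V = {q. Re (q / q0) > 0} \<inter> ball 0 1"
    define \<tau> where "\<tau> = (\<lambda>q. (Ln (q / q0) + Ln q0) / (2 * pi * \<i>))"
    have V: "open V" "q0 \<in> V"
    proof -
      have "{q. Re (q / q0) > 0} = (\<lambda>q. Re (q / q0)) -` {0<..}" by auto
      moreover have "open \<dots>" using q0
        by (intro open_vimage open_greaterThan continuous_intros) auto
      ultimately show "open V" by (simp add: V_def open_Int)
    qed (use q0 in \<open>auto simp: V_def\<close>)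
    have nz: "q / q0 \<notin> \<real>\<^sub>\<le>\<^sub>0" "q \<noteq> 0" if "q \<in> V" for q
      using that by (auto simp: V_def complex_nonpos_Reals_iff)
    have exp\<tau>: "exp (2 * pi * \<i> * \<tau> q) = q" if "q \<in> V" for q
      using nz[OF that] q0 by (simp add: \<tau>_def exp_add)
    have Im\<tau>: "Im (\<tau> q) > 0" if "q \<in> V" for q
    proof -
      have "exp (Re (2 * pi * \<i> * \<tau> q)) = norm q"
        using exp\<tau>[OF that] by (metis norm_exp_eq_Re)
      then have "exp (- 2 * pi * Im (\<tau> q)) < 1" using that by (simp add: V_def)
      then show ?thesis by (simp add: mult_less_0_iff zero_less_mult_iff)
    qed
    have "\<tau> holomorphic_on V"
      unfolding \<tau>_def using nz q0 by (auto intro!: holomorphic_intros)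
    then have "(g \<circ> \<tau>) holomorphic_on V"
      using Im\<tau> by (intro holomorphic_on_compose_gen[OF _ hol]) auto
    then have "G holomorphic_on V"
      using eq[OF Im\<tau>] exp\<tau> by (simp add: o_def cong: holomorphic_cong)
    then show "\<exists>f'. (G has_field_derivative f') (at q0)"
      using V holomorphic_on_open by blast
  qed
qed

text \<open>Exponential growth in \<open>Im \<tau>\<close> is polynomial growth in 1/q, which rules
  out an essential singularity of \<open>G\<close> at q = 0. A finite limit gives the first
  alternative, a pole the second, both uniformly in \<open>Re \<tau>\<close>.\<close>

lemma cusp_dichotomy:
  assumes hol: "g holomorphic_on {\<tau>. Im \<tau> > 0}"
    and T: "\<And>\<tau>. Im \<tau> > 0 \<Longrightarrow> g (\<tau> + 1) = g \<tau>"
    and growth: "\<And>\<tau>. Im \<tau> \<ge> 1 \<Longrightarrow> norm (g \<tau>) \<le> A * exp (N * Im \<tau>)"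
  shows "(\<exists>C. \<forall>\<tau>. Im \<tau> \<ge> 1 \<longrightarrow> norm (g \<tau>) \<le> C) \<or>
     (\<forall>\<epsilon>>0. \<exists>Y\<ge>0. \<forall>\<tau>. Im \<tau> > Y \<longrightarrow> g \<tau> \<noteq> 0 \<and> norm (1 / g \<tau>) \<le> \<epsilon>)"
proof -
  obtain G where G: "G holomorphic_on ball 0 1 - {0}"
    and Gg: "\<And>\<tau>. Im \<tau> > 0 \<Longrightarrow> G (exp (2 * pi * \<i> * \<tau>)) = g \<tau>"
    using q_expansion[OF hol T] by blast
  have A0: "A \<ge> 0" using order_trans[OF norm_ge_zero growth[of \<i>]] by (simp add: zero_le_mult_iff)
  \<comment> \<open>The factor \<open>q ^ m\<close> has modulus exp(-2 pi m Im \<tau>), which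
    cancels the allowed growth.\<close>
  obtain m :: nat where m: "N \<le> 2 * pi * m"
  proof -
    obtain m :: nat where "N / (2 * pi) \<le> m" using real_arch_simple by blast
    then show ?thesis using that[of m] by (simp add: field_simps)
  qed
  have bd: "norm (q ^ m * G q) \<le> A" if q: "q \<noteq> 0" "norm q \<le> exp (- 2 * pi)" for q
  proof -
    define \<tau> where "\<tau> = Ln q / (2 * pi * \<i>)"
    have e: "exp (2 * pi * \<i> * \<tau>) = q" using q by (simp add: \<tau>_def)
    have n: "norm q = exp (- 2 * pi * Im \<tau>)" using e norm_exp_eq_Re[of "2 * pi * \<i> * \<tau>"] by simp
    then have im: "Im \<tau> \<ge> 1" using q(2) by simp
    have "norm (q ^ m * G q) \<le> exp (- 2 * pi * Im \<tau>) ^ m * (A * exp (N * Im \<tau>))"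
      unfolding norm_mult norm_power n using growth[OF im] Gg[of \<tau>] im e
      by (intro mult_left_mono) auto
    also have "\<dots> = A * exp ((N - 2 * pi * m) * Im \<tau>)"
      by (simp add: algebra_simps exp_diff exp_minus field_simps flip: exp_of_nat_mult)
    also have "\<dots> \<le> A * 1"
      using A0 m im by (intro mult_left_mono) (auto simp: mult_nonpos_nonneg)
    finally show ?thesis by simp
  qed
  have ev: "eventually (\<lambda>q. q \<noteq> 0 \<and> norm q < \<delta>) (at 0)" if "\<delta> > 0" for \<delta> and a :: complex
    using that unfolding eventually_at by (auto simp: dist_norm intro!: exI[of _ \<delta>])
  \<comment> \<open>By Riemann's theorem the bounded function \<open>q ^ m * G q\<close> extends
    over 0, so \<open>G\<close> is \<open>P q / q ^ m\<close> there and hence meromorphic.\<close>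
  have "\<exists>P. P holomorphic_on ball 0 1 \<and> (\<forall>q\<in>ball 0 1 - {0}. P q = q ^ m * G q)"
  proof (rule iffD2[OF holomorphic_on_extend_bounded])
    show "(\<lambda>q. q ^ m * G q) holomorphic_on ball 0 1 - {0}"
      by (intro holomorphic_intros G)
    have "\<forall>\<^sub>F q in at 0. norm (q ^ m * G q) \<le> A"
      using ev[of "exp (- 2 * pi)"] by (auto elim!: eventually_mono intro!: bd)
    then show "\<exists>B. \<forall>\<^sub>F q in at 0. norm (q ^ m * G q) \<le> B" by blast
  qed auto
  then obtain P where P: "P holomorphic_on ball 0 1"
    "\<And>q. q \<in> ball 0 1 - {0} \<Longrightarrow> P q = q ^ m * G q" by blast
  have "P analytic_on {0}"
    using P(1) by (meson analytic_at centre_in_ball open_ball zero_less_one)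
  then have "(\<lambda>q. P q / q ^ m) meromorphic_on {0}"
    by (intro meromorphic_intros analytic_on_imp_meromorphic_on)
  then have "not_essential (\<lambda>q. P q / q ^ m) 0"
    by (rule meromorphic_on_not_essential)
  also have "?this \<longleftrightarrow> not_essential G 0"
    by (rule not_essential_cong) (use ev[of 1] P(2) in \<open>auto elim!: eventually_mono\<close>)
  finally consider c where "G \<midarrow>0\<rightarrow> c" | "is_pole G 0" unfolding not_essential_def by blast
  then show ?thesis
  proof cases
    case 1
    have "eventually (\<lambda>q. dist (G q) c < 1) (at 0)" using tendstoD[OF 1, of 1] by simp
    then obtain \<delta> where \<delta>: "\<delta> > 0" "\<And>q. q \<noteq> 0 \<Longrightarrow> norm q < \<delta> \<Longrightarrow> dist (G q) c < 1"
      unfolding eventually_at by (auto simp: dist_norm)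
    \<comment> \<open>\<open>Im \<tau> > Y\<close> says exactly that |q| = exp(-2 pi Im \<tau>) is
      below \<open>\<delta>\<close>. The remaining strip up to height \<open>Y\<close> is covered by
      the growth bound.\<close>
    define Y where "Y = - ln \<delta> / (2 * pi)"
    have "norm (g \<tau>) \<le> max (norm c + 1) (A * exp (\<bar>N\<bar> * Y))" if \<tau>: "Im \<tau> \<ge> 1" for \<tau>
    proof (cases "Im \<tau> > Y")
      case True
      then have "- 2 * pi * Im \<tau> < ln \<delta>" by (simp add: Y_def field_simps)
      then have "norm (exp (2 * pi * \<i> * \<tau>)) < \<delta>" using \<delta>(1)
        exp_less_cancel_iff[of "- 2 * pi * Im \<tau>" "ln \<delta>"] by simp
      then have "dist (g \<tau>) c < 1" using \<delta>(2)[of "exp (2 * pi * \<i> * \<tau>)"] Gg[of \<tau>] \<tau> by simp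
      then show ?thesis using norm_triangle_ineq2[of "g \<tau>" c] by (simp add: dist_norm)
    next
      case False
      have "N * Im \<tau> \<le> \<bar>N\<bar> * Y" using False \<tau> by (intro mult_mono) auto
      then have "A * exp (N * Im \<tau>) \<le> A * exp (\<bar>N\<bar> * Y)" using A0 by (simp add: mult_left_mono)
      then show ?thesis using growth[OF \<tau>] by simp
    qed
    then show ?thesis by blast
  next
    case 2
    have "\<exists>Y\<ge>0. \<forall>\<tau>. Im \<tau> > Y \<longrightarrow> g \<tau> \<noteq> 0 \<and> norm (1 / g \<tau>) \<le> \<epsilon>" if "\<epsilon> > 0" for \<epsilon>
    proof -
      have "eventually (\<lambda>q. norm (G q) \<ge> 1 / \<epsilon>) (at 0)"
        using 2 that unfolding is_pole_def filterlim_at_infinity[OF order_refl] by simp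
      then obtain \<delta> where \<delta>: "\<delta> > 0" "\<And>q. q \<noteq> 0 \<Longrightarrow> norm q < \<delta> \<Longrightarrow> norm (G q) \<ge> 1 / \<epsilon>"
        unfolding eventually_at by (auto simp: dist_norm)
      define Y where "Y = max 0 (- ln \<delta> / (2 * pi))"
      have "g \<tau> \<noteq> 0 \<and> norm (1 / g \<tau>) \<le> \<epsilon>" if \<tau>: "Im \<tau> > Y" for \<tau>
      proof -
        have "- 2 * pi * Im \<tau> < ln \<delta>" using \<tau> by (simp add: Y_def field_simps)
        then have "norm (exp (2 * pi * \<i> * \<tau>)) < \<delta>" using \<delta>(1)
          exp_less_cancel_iff[of "- 2 * pi * Im \<tau>" "ln \<delta>"] by simp
        then have n: "norm (g \<tau>) \<ge> 1 / \<epsilon>"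
          using \<delta>(2)[of "exp (2 * pi * \<i> * \<tau>)"] Gg[of \<tau>] \<tau> by (simp add: Y_def)
        then have "norm (g \<tau>) > 0" using \<open>\<epsilon> > 0\<close> by (smt (verit) zero_less_divide_1_iff)
        then show ?thesis using n \<open>\<epsilon> > 0\<close> by (auto simp: norm_divide field_simps)
      qed
      moreover have "Y \<ge> 0" by (simp add: Y_def)
      ultimately show ?thesis by blast
    qed
    then show ?thesis by blast
  qed
qed

section \<open>Growth of solutions of a linear system along vertical lines\<close>

text \<open>Gronwall's argument: the energy, the sum of the squared moduli of the three components,
  has logarithmic derivative at most \<open>2 * (1 + B)\<close> in the vertical direction wherever
  it is nonzero.\<close>

lemma linear_system_growth:
  fixes g g1 k S :: "complex \<Rightarrow> complex" and B :: real
  assumes dg: "\<And>\<tau>. Im \<tau> \<ge> 1 \<Longrightarrow> (g has_field_derivative g1 \<tau>) (at \<tau>)"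
    and dg1: "\<And>\<tau>. Im \<tau> \<ge> 1 \<Longrightarrow> (g1 has_field_derivative (k \<tau> - S \<tau> * g \<tau>)) (at \<tau>)"
    and dk: "\<And>\<tau>. Im \<tau> \<ge> 1 \<Longrightarrow> (k has_field_derivative (- S \<tau> * g1 \<tau>)) (at \<tau>)"
    and B: "\<And>\<tau>. Im \<tau> \<ge> 1 \<Longrightarrow> norm (S \<tau>) \<le> B"
    and y: "y \<ge> 1"
  shows "(norm (g (Complex x y)))\<^sup>2 \<le>
     ((norm (g (Complex x 1)))\<^sup>2 + (norm (g1 (Complex x 1)))\<^sup>2 + (norm (k (Complex x 1)))\<^sup>2)
        * exp (2 * (1 + B) * (y - 1))"
proof -
  define E where "E = (\<lambda>t. g (Complex x t) \<bullet> g (Complex x t) + g1 (Complex x t) \<bullet> g1 (Complex x t)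
     + k (Complex x t) \<bullet> k (Complex x t))"
  \<comment> \<open>The factors \<open>\<i>\<close> come from differentiating along \<tau> = x +
    it.\<close>
  define E' where "E' = (\<lambda>t. 2 * (g (Complex x t) \<bullet> (\<i> * g1 (Complex x t)))
     + 2 * (g1 (Complex x t) \<bullet> (\<i> * (k (Complex x t) - S (Complex x t) * g (Complex x t))))
     + 2 * (k (Complex x t) \<bullet> (\<i> * (- S (Complex x t) * g1 (Complex x t)))))"
  have vd: "((\<lambda>t. f (Complex x t)) has_vector_derivative (\<i> * D)) (at t)"
    if "(f has_field_derivative D) (at (Complex x t))" for f D t
  proof -
    have "((\<lambda>t. of_real x + \<i> * of_real t) has_vector_derivative \<i>) (at t)"
      by (auto intro!: derivative_eq_intros)
    also have "(\<lambda>t. of_real x + \<i> * of_real t) = Complex x"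
      by (simp add: fun_eq_iff Complex_eq)
    finally have "(Complex x has_vector_derivative \<i>) (at t)" .
    from field_vector_diff_chain_at[OF this that] show ?thesis by (simp add: o_def)
  qed
  have sq: "((\<lambda>t. f t \<bullet> f t) has_real_derivative 2 * (f t \<bullet> d)) (at t)"
    if "(f has_vector_derivative d) (at t)" for f :: "real \<Rightarrow> complex" and d t
    using has_derivative_inner[OF that[unfolded has_vector_derivative_def] that[unfolded has_vector_derivative_def]]
    unfolding has_field_derivative_def
    by (rule has_derivative_eq_rhs) (auto simp: inner_commute algebra_simps fun_eq_iff)
  have dE: "(E has_real_derivative E' t) (at t)" if "t \<ge> 1" for t
    unfolding E_def E'_def
    by (intro derivative_intros sq vd dg dg1 dk) (use that in auto)
  have B0: "B \<ge> 0" using order_trans[OF norm_ge_zero B[of \<i>]] by simp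
  have E0: "E t \<ge> 0" for t by (simp add: E_def)
  have bd: "E' t \<le> 2 * (1 + B) * E t" if t: "t \<ge> 1" for t
  proof -
    let ?z = "Complex x t"
    let ?a = "norm (g ?z)" and ?b = "norm (g1 ?z)" and ?c = "norm (k ?z)"
    have S: "norm (S ?z) \<le> B" using B t by simp
    have cs: "u \<bullet> (\<i> * v) \<le> norm u * norm v" for u v :: complex
      using norm_cauchy_schwarz[of u "\<i> * v"] by (simp add: norm_mult)
    have "g ?z \<bullet> (\<i> * g1 ?z) \<le> ?a * ?b" by (rule cs)
    moreover have "g1 ?z \<bullet> (\<i> * (k ?z - S ?z * g ?z)) \<le> ?b * (?c + B * ?a)"
    proof -
      have "norm (k ?z - S ?z * g ?z) \<le> ?c + norm (S ?z) * ?a"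
        by (metis norm_triangle_ineq4 norm_mult)
      also have "\<dots> \<le> ?c + B * ?a" using S by (intro add_left_mono mult_right_mono) auto
      finally show ?thesis by (intro order_trans[OF cs] mult_left_mono) auto
    qed
    moreover have "k ?z \<bullet> (\<i> * (- S ?z * g1 ?z)) \<le> ?c * (B * ?b)"
      using S by (intro order_trans[OF cs] mult_left_mono) (auto simp: norm_mult intro: mult_right_mono)
    \<comment> \<open>The products ab and bc each occur once with coefficient 2 and once with
      2B.\<close>
    ultimately have "E' t \<le> 2 * (1 + B) * (?a * ?b + ?b * ?c)"
      using B0 unfolding E'_def by (simp add: algebra_simps)
    also have "?a * ?b + ?b * ?c \<le> E t"
    proof -
      have "2 * (?a * ?b) \<le> ?a\<^sup>2 + ?b\<^sup>2" "2 * (?b * ?c) \<le> ?b\<^sup>2 + ?c\<^sup>2"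
        using sum_squares_bound[of ?a ?b] sum_squares_bound[of ?b ?c] by simp_all
      moreover have "E t = ?a\<^sup>2 + ?b\<^sup>2 + ?c\<^sup>2" by (simp add: E_def dot_square_norm)
      moreover have "?a\<^sup>2 \<ge> 0" "?c\<^sup>2 \<ge> 0" by auto
      ultimately show ?thesis by linarith
    qed
    finally show ?thesis using B0 by (simp add: mult_left_mono)
  qed
  let ?M = "2 * (1 + B)"
  \<comment> \<open>The energy damped by its maximal growth rate is nonincreasing.\<close>
  have "E y * exp (- ?M * (y - 1)) \<le> E 1 * exp (- ?M * (1 - 1))"
  proof (rule DERIV_nonpos_imp_nonincreasing[OF y])
    fix t :: real assume t: "1 \<le> t" "t \<le> y"
    have "((\<lambda>t. E t * exp (- ?M * (t - 1))) has_real_derivative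
       (E' t - ?M * E t) * exp (- ?M * (t - 1))) (at t)"
      using t by (auto intro!: derivative_eq_intros dE simp: algebra_simps)
    moreover have "(E' t - ?M * E t) * exp (- ?M * (t - 1)) \<le> 0"
      using bd[OF t(1)] by (intro mult_nonpos_nonneg) auto
    ultimately show "\<exists>d. ((\<lambda>t. E t * exp (- ?M * (t - 1))) has_real_derivative d) (at t) \<and> d \<le> 0"
      by blast
  qed
  then have "E y * exp (- ?M * (y - 1)) * exp (?M * (y - 1)) \<le> E 1 * exp (?M * (y - 1))"
    by (intro mult_right_mono) auto
  moreover have "exp (- ?M * (y - 1)) * exp (?M * (y - 1)) = 1"
    by (simp add: algebra_simps flip: exp_add)
  ultimately have "E y \<le> E 1 * exp (?M * (y - 1))"
    by (metis mult.assoc mult.right_neutral)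
  moreover have "(norm (g (Complex x y)))\<^sup>2 \<le> E y"
    by (simp add: E_def dot_square_norm)
  moreover have "E 1 = (norm (g (Complex x 1)))\<^sup>2 + (norm (g1 (Complex x 1)))\<^sup>2 + (norm (k (Complex x 1)))\<^sup>2"
    by (simp add: E_def dot_square_norm)
  ultimately show ?thesis by simp
qed

section \<open>Weight $-2$\<close>

text \<open>Translating to \<open>\<bar>Re \<tau>\<bar> \<le> 1/2\<close> and then inverting at least doubles an
  imaginary part below \<open>1/2\<close>.\<close>
lemma modular_reduction:
  fixes \<phi> :: "complex \<Rightarrow> 'a"
  assumes T: "\<And>\<tau>. Im \<tau> > 0 \<Longrightarrow> \<phi> (\<tau> + 1) = \<phi> \<tau>"
    and S: "\<And>\<tau>. Im \<tau> > 0 \<Longrightarrow> \<phi> (- 1 / \<tau>) = \<phi> \<tau>"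
    and \<tau>: "Im \<tau> > 0"
  obtains \<tau>' where "\<bar>Re \<tau>'\<bar> \<le> 1/2" "Im \<tau>' \<ge> 1/2" "\<phi> \<tau>' = \<phi> \<tau>"
proof -
  have trans: "\<exists>\<tau>'. \<bar>Re \<tau>'\<bar> \<le> 1/2 \<and> Im \<tau>' = Im \<tau> \<and> \<phi> \<tau>' = \<phi> \<tau>" if "Im \<tau> > 0" for \<tau>
  proof (intro exI conjI)
    let ?t = "\<tau> + of_int (- round (Re \<tau>))"
    show "\<bar>Re ?t\<bar> \<le> 1/2"
      using of_int_round_abs_le[of "Re \<tau>"] by (simp add: abs_minus_commute)
  qed (use periodic_upper_half_plane_int[of \<phi>, OF T that, of "- round (Re \<tau>)"] in auto)
  \<comment> \<open>\<open>n\<close> bounds the number of doublings still needed to bring the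
    imaginary part up to 1/2; it is the induction measure.\<close>
  have "\<exists>\<tau>'. \<bar>Re \<tau>'\<bar> \<le> 1/2 \<and> Im \<tau>' \<ge> 1/2 \<and> \<phi> \<tau>' = \<phi> \<tau>"
    if "Im \<tau> > 0" "Im \<tau> * 2 ^ n \<ge> 1/2" for n
    using that
  proof (induction n arbitrary: \<tau>)
    case 0
    then show ?case using trans[of \<tau>] by auto
  next
    case (Suc n)
    obtain t where t: "\<bar>Re t\<bar> \<le> 1/2" "Im t = Im \<tau>" "\<phi> t = \<phi> \<tau>"
      using trans[OF Suc.prems(1)] by blast
    show ?case
    proof (cases "Im t \<ge> 1/2")
      case True
      then show ?thesis using t by blast
    next
      case False
      let ?r = "(Re t)\<^sup>2 + (Im t)\<^sup>2"
      have pos: "Im t > 0" using t Suc.prems by simp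
      \<comment> \<open>Both coordinates are at most 1/2 in modulus, so |t|^2 is at most 1/2, and
        inversion divides the imaginary part by this number.\<close>
      have "\<bar>Re t\<bar>\<^sup>2 \<le> (1/2)\<^sup>2" "(Im t)\<^sup>2 \<le> (1/2)\<^sup>2"
        using t False pos by (intro power_mono; simp)+
      then have r: "?r \<le> 1/2" "?r > 0" using pos by (auto simp: power2_eq_square intro: add_nonneg_pos)
      have im: "Im (- 1 / t) = Im t / ?r" by (simp add: Im_divide)
      have "Im t * 2 \<le> Im t / ?r"
        using r pos mult_left_mono[of "2 * ?r" 1 "Im t"]
        by (simp add: pos_le_divide_eq mult_ac)
      then have "Im (- 1 / t) \<ge> 2 * Im \<tau>" using im t(2) by simp
      then have "Im (- 1 / t) > 0" "Im (- 1 / t) * 2 ^ n \<ge> 1/2"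
        using Suc.prems mult_right_mono[of "2 * Im \<tau>" "Im (- 1 / t)" "2 ^ n"] by (auto simp: mult_ac)
      from Suc.IH[OF this] show ?thesis using S[OF pos] t(3) by simp
    qed
  qed
  moreover obtain n where "Im \<tau> * 2 ^ n \<ge> 1/2"
  proof -
    obtain n where "1 / 2 / Im \<tau> < 2 ^ n" using real_arch_pow[of 2 "1 / 2 / Im \<tau>"] by auto
    then show ?thesis using that \<tau> by (auto simp: field_simps intro: less_imp_le)
  qed
  ultimately show ?thesis using \<tau> that by blast
qed

text \<open>\<open>|g| / Im\<close> is invariant under the modular group and would have an interior maximum;
  since \<open>4 Im \<tau> Im \<tau>\<^sub>0 \<le> |\<tau> - cnj \<tau>\<^sub>0|\<^sup>2\<close>, so would the modulus of the holomorphic function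
  \<open>g(\<tau>) / (\<tau> - cnj \<tau>\<^sub>0)\<^sup>2\<close>.\<close>
lemma weight_minus_2_bounded_imp_zero:
  assumes hol: "g holomorphic_on {\<tau>. Im \<tau> > 0}"
    and T: "\<And>\<tau>. Im \<tau> > 0 \<Longrightarrow> g (\<tau> + 1) = g \<tau>"
    and S: "\<And>\<tau>. Im \<tau> > 0 \<Longrightarrow> g (- 1 / \<tau>) = g \<tau> / \<tau>\<^sup>2"
    and C: "\<And>\<tau>. Im \<tau> \<ge> 1 \<Longrightarrow> norm (g \<tau>) \<le> C"
    and z: "Im z > 0"
  shows "g z = 0"
proof (rule ccontr)
  assume gz: "g z \<noteq> 0"
  define \<phi> where "\<phi> = (\<lambda>\<tau>. norm (g \<tau>) / Im \<tau>)"
  have \<phi>T: "\<phi> (\<tau> + 1) = \<phi> \<tau>" if "Im \<tau> > 0" for \<tau> using T[OF that] by (simp add: \<phi>_def)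
  have \<phi>S: "\<phi> (- 1 / \<tau>) = \<phi> \<tau>" if "Im \<tau> > 0" for \<tau>
  proof -
    have "\<tau> \<noteq> 0" using that by auto
    have "Im (- 1 / \<tau>) = Im \<tau> / (norm \<tau>)\<^sup>2" by (simp add: Im_divide cmod_power2)
    then show ?thesis using that \<open>\<tau> \<noteq> 0\<close> unfolding \<phi>_def S[OF that] by (simp add: norm_divide norm_power)
  qed
  define m where "m = \<phi> z"
  have m: "m > 0" using gz z by (simp add: m_def \<phi>_def)
  \<comment> \<open>Above height \<open>Y\<close> the bound \<open>C / Im \<tau>\<close> falls below
    the value \<open>m\<close> already taken by \<open>\<phi>\<close>. So a maximum over the compact
    box \<open>K\<close>, which starts at the height 1/2 guaranteed by
    \<open>modular_reduction\<close>, is a global maximum.\<close>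
  define Y where "Y = max 1 (2 * C / m)"
  have C0: "C \<ge> 0" using order_trans[OF norm_ge_zero C[of \<i>]] by simp
  have small: "\<phi> \<tau> < m" if "Im \<tau> > Y" for \<tau>
  proof -
    have *: "Im \<tau> > 1" "Im \<tau> > 2 * C / m" using that by (auto simp: Y_def)
    then have "\<phi> \<tau> \<le> C / Im \<tau>" using C[of \<tau>] by (simp add: \<phi>_def divide_right_mono)
    also have "\<dots> < m" using * m C0 by (simp add: field_simps)
    finally show ?thesis .
  qed
  define K where "K = {\<tau>. \<bar>Re \<tau>\<bar> \<le> 1/2 \<and> 1/2 \<le> Im \<tau> \<and> Im \<tau> \<le> Y}"
  have K_eq: "K = cbox (Complex (-1/2) (1/2)) (Complex (1/2) Y)"
    by (auto simp: K_def in_cbox_complex_iff)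
  have cont: "continuous_on K \<phi>"
    unfolding \<phi>_def
    by (intro continuous_intros holomorphic_on_imp_continuous_on holomorphic_on_subset[OF hol])
       (auto simp: K_def)
  obtain z' where z': "\<bar>Re z'\<bar> \<le> 1/2" "Im z' \<ge> 1/2" "\<phi> z' = m"
    using modular_reduction[of \<phi> z, OF \<phi>T \<phi>S z] m_def by metis
  then have "z' \<in> K" using small[of z'] by (force simp: K_def)
  then obtain \<tau>0 where \<tau>0: "\<tau>0 \<in> K" "\<And>\<tau>. \<tau> \<in> K \<Longrightarrow> \<phi> \<tau> \<le> \<phi> \<tau>0"
    using continuous_attains_sup[of K \<phi>] cont K_eq compact_cbox by (metis empty_iff)
  have y0: "Im \<tau>0 > 0" using \<tau>0 by (auto simp: K_def)
  have max: "\<phi> \<tau> \<le> \<phi> \<tau>0" if \<tau>: "Im \<tau> > 0" for \<tau>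
  proof -
    obtain t where t: "\<bar>Re t\<bar> \<le> 1/2" "Im t \<ge> 1/2" "\<phi> t = \<phi> \<tau>"
      using modular_reduction[of \<phi> \<tau>, OF \<phi>T \<phi>S \<tau>] by metis
    show ?thesis
    proof (cases "Im t \<le> Y")
      case True
      then show ?thesis using t \<tau>0(2)[of t] by (auto simp: K_def)
    next
      case False
      then show ?thesis using small[of t] \<tau>0(2)[OF \<open>z' \<in> K\<close>] z' t by simp
    qed
  qed
  have m0: "\<phi> \<tau>0 > 0" using max[OF z] m by (simp add: m_def)
  have ne: "\<tau> - cnj \<tau>0 \<noteq> 0" if "Im \<tau> > 0" for \<tau>
    using that y0 by (auto simp: complex_eq_iff)
  define G where "G = (\<lambda>\<tau>. g \<tau> / (\<tau> - cnj \<tau>0)\<^sup>2)"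
  have Gn: "norm (G \<tau>) = \<phi> \<tau> * Im \<tau> / (norm (\<tau> - cnj \<tau>0))\<^sup>2" if "Im \<tau> > 0" for \<tau>
    using that by (simp add: G_def \<phi>_def norm_divide norm_power)
  have G0: "norm (G \<tau>0) = \<phi> \<tau>0 / (4 * Im \<tau>0)"
  proof -
    have "\<tau>0 - cnj \<tau>0 = of_real (2 * Im \<tau>0) * \<i>" by (simp add: complex_eq_iff)
    then have "norm (\<tau>0 - cnj \<tau>0) = 2 * Im \<tau>0" using y0 by (simp add: norm_mult)
    then show ?thesis using Gn[OF y0] y0 by (simp add: field_simps power2_eq_square)
  qed
  have Gmax: "norm (G \<tau>) \<le> norm (G \<tau>0)" if \<tau>: "Im \<tau> > 0" for \<tau>
  proof -
    have "(norm (\<tau> - cnj \<tau>0))\<^sup>2 = (Re \<tau> - Re \<tau>0)\<^sup>2 + (Im \<tau> + Im \<tau>0)\<^sup>2"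
      by (simp add: cmod_power2)
    also have "\<dots> = (Re \<tau> - Re \<tau>0)\<^sup>2 + (Im \<tau> - Im \<tau>0)\<^sup>2 + 4 * Im \<tau> * Im \<tau>0"
      by (simp add: power2_eq_square algebra_simps)
    finally have d: "(norm (\<tau> - cnj \<tau>0))\<^sup>2 \<ge> 4 * Im \<tau> * Im \<tau>0"
      by simp
    have "norm (G \<tau>) \<le> \<phi> \<tau>0 * Im \<tau> / (4 * Im \<tau> * Im \<tau>0)"
      unfolding Gn[OF \<tau>] using \<tau> y0 m0 d max[OF \<tau>]
      by (intro frac_le mult_right_mono mult_nonneg_nonneg) auto
    also have "\<dots> = norm (G \<tau>0)" using \<tau> y0 G0 by (simp add: field_simps)
    finally show ?thesis .
  qed
  have "G constant_on {\<tau>. Im \<tau> > 0}"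
  proof (rule maximum_modulus_principle[where U = "{\<tau>. Im \<tau> > 0}" and \<xi> = \<tau>0])
    show "G holomorphic_on {\<tau>. Im \<tau> > 0}"
      unfolding G_def using ne by (auto intro!: holomorphic_intros hol)
    show "open {\<tau>. Im \<tau> > 0}" by (rule open_halfspace_Im_gt)
    then show "open {\<tau>. Im \<tau> > 0}" .
    show "connected {\<tau>. Im \<tau> > 0}" by (intro convex_connected convex_halfspace_Im_gt)
  qed (use y0 Gmax in auto)
  \<comment> \<open>A constant \<open>G\<close> is refuted at the point twice as high as \<tau>0:
    there its modulus is at most 2/9 of \<open>\<phi> \<tau>0 / Im \<tau>0\<close>, while at \<tau>0
    it is 1/4 of it.\<close>
  then have G1: "G (\<tau>0 + \<i> * Im \<tau>0) = G \<tau>0"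
    using y0 unfolding constant_on_def by auto
  have "\<tau>0 + \<i> * Im \<tau>0 - cnj \<tau>0 = of_real (3 * Im \<tau>0) * \<i>" by (simp add: complex_eq_iff)
  then have "norm (\<tau>0 + \<i> * Im \<tau>0 - cnj \<tau>0) = norm (of_real (3 * Im \<tau>0) * \<i>)"
    by (rule arg_cong)
  also have "\<dots> = 3 * Im \<tau>0" using y0 unfolding norm_mult norm_of_real by simp
  finally have "norm (\<tau>0 + \<i> * Im \<tau>0 - cnj \<tau>0) = 3 * Im \<tau>0" .
  then have "norm (G (\<tau>0 + \<i> * Im \<tau>0)) = \<phi> (\<tau>0 + \<i> * Im \<tau>0) * (2 * Im \<tau>0) / (3 * Im \<tau>0)\<^sup>2"
    using Gn[of "\<tau>0 + \<i> * Im \<tau>0"] y0 by simp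
  also have "\<dots> \<le> \<phi> \<tau>0 * (2 * Im \<tau>0) / (3 * Im \<tau>0)\<^sup>2"
    using max[of "\<tau>0 + \<i> * Im \<tau>0"] y0 by (intro divide_right_mono mult_right_mono) auto
  also have "\<dots> < norm (G \<tau>0)" using y0 m0 unfolding G0 by (simp add: field_simps power2_eq_square)
  finally show False using G1 by simp
qed

section \<open>Finite reducible groups of Moebius transformations\<close>

text \<open>A homomorphism is constant on each coset of its kernel, and the cosets cover the
  group.\<close>

lemma (in group_hom) finite_image_finite_index_kernel:
  assumes fin: "finite (rcosets (kernel G H h))"
  shows "finite (h ` carrier G)"
proof -
  have sub: "h ` carrier G \<subseteq> (\<Union>K\<in>rcosets (kernel G H h). h ` K)"
  proof
    fix y assume "y \<in> h ` carrier G"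
    then obtain x where x: "x \<in> carrier G" "y = h x" by blast
    have "x \<in> kernel G H h #> x" using x(1) subgroup_kernel by (rule G.rcos_self)
    moreover have "kernel G H h #> x \<in> rcosets (kernel G H h)"
      using x(1) by (intro G.rcosetsI subgroup.subset subgroup_kernel)
    ultimately show "y \<in> (\<Union>K\<in>rcosets (kernel G H h). h ` K)" using x(2) by blast
  qed
  show ?thesis
  proof (rule finite_subset[OF sub finite_UN_I[OF fin]])
    fix K assume "K \<in> rcosets (kernel G H h)"
    then obtain x where x: "x \<in> carrier G" "K = kernel G H h #> x"
      unfolding RCOSETS_def by blast
    have "h y = h x" if "y \<in> K" for y
      using that x(1) unfolding x(2) r_coset_def by (auto simp: kernel_def)
    then have "h ` K \<subseteq> {h x}" by blast
    then show "finite (h ` K)" by (rule finite_subset) simp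
  qed
qed

section \<open>The action of the projective linear group on the projective line\<close>

lemma PGL2C_rep:
  assumes "X \<in> carrier PGL2C"
  obtains A where "invertible A" "X = scalars2C #>\<^bsub>GL2C\<^esub> A"
  using assms by (auto simp: PGL2C_def FactGroup_def RCOSETS_def GL2C_def)

lemma pgl_act_mult:
  assumes "X \<in> carrier PGL2C" "Y \<in> carrier PGL2C"
  shows "pgl_act (X \<otimes>\<^bsub>PGL2C\<^esub> Y) p = pgl_act X (pgl_act Y p)"
proof -
  obtain A where A: "invertible A" "X = scalars2C #>\<^bsub>GL2C\<^esub> A" using PGL2C_rep assms(1) by blast
  obtain B where B: "invertible B" "Y = scalars2C #>\<^bsub>GL2C\<^esub> B" using PGL2C_rep assms(2) by blast
  have "X \<otimes>\<^bsub>PGL2C\<^esub> Y = scalars2C #>\<^bsub>GL2C\<^esub> (A ** B)"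
    using normal.rcos_sum[OF normal_scalars2C, of A B] A B
    by (simp add: PGL2C_def FactGroup_def) (simp add: GL2C_def)
  then show ?thesis using A B by (simp add: pgl_act_coset lft_mult)
qed

text \<open>Fixing infinity forces the lower left entry to vanish, and invertibility then makes both
  diagonal entries nonzero.\<close>

lemma lft_fix_infinity:
  assumes A: "invertible A" and fx: "lft A None = None"
  obtains a b where "a \<noteq> 0" "lft A = map_option (\<lambda>x. a * x + b)"
proof
  have c: "A$2$1 = 0" using fx by (auto simp: lft_def split: if_splits)
  then have nz: "A$1$1 \<noteq> 0" "A$2$2 \<noteq> 0" using A by (auto simp: invertible_det_nz det_2)
  then show "A$1$1 / A$2$2 \<noteq> 0" by simp
  show "lft A = map_option (\<lambda>x. (A$1$1 / A$2$2) * x + A$1$2 / A$2$2)"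
    using c nz by (auto simp: fun_eq_iff lft_def add_divide_distrib split: option.splits)
qed

lemma lft_mat_1: "lft (mat 1) p = p"
  by (auto simp: lft_def mat_def split: option.splits)

text \<open>After moving the fixed point to infinity the group acts by finitely many affine maps, and
  the average of the finite orbit of \<open>0\<close> is a second fixed point.\<close>
lemma finite_reducible_diagonal:
  assumes hom: "\<rho> \<in> hom SL2Z PGL2C" and red: "reducible_representation \<rho>"
    and fin: "finite (\<rho> ` carrier SL2Z)"
  obtains D \<alpha> where "invertible D"
    "\<And>\<gamma> p. \<gamma> \<in> carrier SL2Z \<Longrightarrow> lft D (pgl_act (\<rho> \<gamma>) p) = map_option (\<lambda>x. \<alpha> \<gamma> * x) (lft D p)"
    "\<And>\<gamma>. \<gamma> \<in> carrier SL2Z \<Longrightarrow> \<alpha> \<gamma> \<noteq> 0"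
    "\<And>\<gamma> \<delta>. \<gamma> \<in> carrier SL2Z \<Longrightarrow> \<delta> \<in> carrier SL2Z \<Longrightarrow> \<alpha> (\<gamma> ** \<delta>) = \<alpha> \<gamma> * \<alpha> \<delta>"
proof -
  interpret group SL2Z by (rule group_SL2Z)
  let ?\<Gamma> = "carrier SL2Z"
  have mult: "\<gamma> ** \<delta> = \<gamma> \<otimes>\<^bsub>SL2Z\<^esub> \<delta>" for \<gamma> \<delta> by (simp add: SL2Z_def)
  have mc: "\<gamma> ** \<delta> \<in> ?\<Gamma>" if "\<gamma> \<in> ?\<Gamma>" "\<delta> \<in> ?\<Gamma>" for \<gamma> \<delta> using that by (simp add: mult)
  have \<rho>c: "\<rho> \<gamma> \<in> carrier PGL2C" if "\<gamma> \<in> ?\<Gamma>" for \<gamma> using hom that by (auto simp: hom_def)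
  have act: "pgl_act (\<rho> (\<gamma> ** \<delta>)) p = pgl_act (\<rho> \<gamma>) (pgl_act (\<rho> \<delta>) p)"
    if "\<gamma> \<in> ?\<Gamma>" "\<delta> \<in> ?\<Gamma>" for \<gamma> \<delta> p
    using hom that by (simp add: mult hom_mult pgl_act_mult \<rho>c)
  obtain p0 where p0: "\<And>\<gamma>. \<gamma> \<in> ?\<Gamma> \<Longrightarrow> pgl_act (\<rho> \<gamma>) p0 = p0"
    using red unfolding reducible_representation_def by blast
  obtain C where C: "invertible C" "lft C p0 = None"
  proof (cases p0)
    case None
    then show ?thesis using that[of "mat 1"] by (simp add: lft_mat_1 mat_invertible_2)
  next
    case (Some z)
    \<comment> \<open>This is the map x to 1 / (x - z), which moves the finite fixed point to
      infinity.\<close>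
    let ?C = "vector [vector [0, 1], vector [1, - z]] :: complex^2^2"
    show ?thesis by (rule that[of ?C]) (auto simp: Some lft_def invertible_det_nz det_2)
  qed
  obtain C' where C': "C ** C' = mat 1" "C' ** C = mat 1" using C(1) by (auto simp: invertible_def)
  then have C'i: "invertible C'" by (auto simp: invertible_def)
  have CC': "lft C (lft C' p) = p" "lft C' (lft C p) = p" for p
    using lft_mult[OF C(1) C'i, of p] lft_mult[OF C'i C(1), of p] C' by (simp_all add: lft_mat_1)
  \<comment> \<open>The coefficients are chosen for each element of the finite image and not for
    each \<open>\<gamma>\<close>, so that only finitely many values \<open>b\<close> arise.\<close>
  have "\<exists>a b. a \<noteq> 0 \<and> (\<forall>p. lft C (pgl_act X p) = map_option (\<lambda>x. a * x + b) (lft C p))"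
    if X: "X \<in> \<rho> ` ?\<Gamma>" for X
  proof -
    obtain A where A: "invertible A" "X = scalars2C #>\<^bsub>GL2C\<^esub> A" using PGL2C_rep X \<rho>c by blast
    have eq: "lft C (pgl_act X p) = lft (C ** A ** C') (lft C p)" for p
      using A C(1) C'i CC' by (simp add: lft_mult invertible_mult pgl_act_coset)
    have "lft (C ** A ** C') None = None" using eq[of p0] p0 X C by auto
    then show ?thesis
      using lft_fix_infinity[of "C ** A ** C'"] A C(1) C'i invertible_mult eq by metis
  qed
  then obtain a b where ab: "\<And>X. X \<in> \<rho> ` ?\<Gamma> \<Longrightarrow> a X \<noteq> 0"
    "\<And>X p. X \<in> \<rho> ` ?\<Gamma> \<Longrightarrow> lft C (pgl_act X p) = map_option (\<lambda>x. a X * x + b X) (lft C p)"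
    by metis
  have comp: "a (\<rho> (\<gamma> ** \<delta>)) * x + b (\<rho> (\<gamma> ** \<delta>)) = a (\<rho> \<gamma>) * (a (\<rho> \<delta>) * x + b (\<rho> \<delta>)) + b (\<rho> \<gamma>)"
    if "\<gamma> \<in> ?\<Gamma>" "\<delta> \<in> ?\<Gamma>" for \<gamma> \<delta> x
    using ab(2)[of "\<rho> (\<gamma> ** \<delta>)" "lft C' (Some x)"] that mc[OF that]
    by (simp add: act ab(2) CC')
  have bm: "b (\<rho> (\<gamma> ** \<delta>)) = a (\<rho> \<gamma>) * b (\<rho> \<delta>) + b (\<rho> \<gamma>)" if "\<gamma> \<in> ?\<Gamma>" "\<delta> \<in> ?\<Gamma>" for \<gamma> \<delta>
    using comp[OF that, of 0] by simp
  have am: "a (\<rho> (\<gamma> ** \<delta>)) = a (\<rho> \<gamma>) * a (\<rho> \<delta>)" if "\<gamma> \<in> ?\<Gamma>" "\<delta> \<in> ?\<Gamma>" for \<gamma> \<delta>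
    using comp[OF that, of 1] bm[OF that] by (simp add: algebra_simps)
  \<comment> \<open>\<open>b\<close> is the image of 0 under the affine map, so \<open>R\<close> is
    the orbit of 0. Each group element permutes it and, being affine, fixes its centroid
    \<open>q\<close>.\<close>
  define R where "R = b ` \<rho> ` ?\<Gamma>"
  have R: "finite R" "R \<noteq> {}" using fin one_closed by (auto simp: R_def)
  define q where "q = (\<Sum>x\<in>R. x) / of_nat (card R)"
  have q: "a (\<rho> \<gamma>) * q + b (\<rho> \<gamma>) = q" if \<gamma>: "\<gamma> \<in> ?\<Gamma>" for \<gamma>
  proof -
    let ?f = "\<lambda>x. a (\<rho> \<gamma>) * x + b (\<rho> \<gamma>)"
    have inj: "inj_on ?f R" using ab(1) \<gamma> by (auto simp: inj_on_def)
    have "?f ` R \<subseteq> R"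
    proof safe
      fix x assume "x \<in> R"
      then obtain \<delta> where \<delta>: "\<delta> \<in> ?\<Gamma>" "x = b (\<rho> \<delta>)" by (auto simp: R_def)
      then show "?f x \<in> R" using bm[OF \<gamma> \<delta>(1)] mc[OF \<gamma> \<delta>(1)] unfolding R_def by (metis image_eqI)
    qed
    then have "?f ` R = R" using inj R(1) by (intro card_subset_eq) (auto simp: card_image)
    then have "(\<Sum>x\<in>R. x) = (\<Sum>x\<in>R. ?f x)" by (metis (no_types, lifting) inj sum.reindex_cong)
    also have "\<dots> = a (\<rho> \<gamma>) * (\<Sum>x\<in>R. x) + of_nat (card R) * b (\<rho> \<gamma>)"
      by (simp add: sum.distrib sum_distrib_left)
    finally have *: "(\<Sum>x\<in>R. x) = a (\<rho> \<gamma>) * (\<Sum>x\<in>R. x) + of_nat (card R) * b (\<rho> \<gamma>)" .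
    have "of_nat (card R) \<noteq> (0 :: complex)" using R by simp
    then have "a (\<rho> \<gamma>) * q + b (\<rho> \<gamma>) = (a (\<rho> \<gamma>) * (\<Sum>x\<in>R. x) + of_nat (card R) * b (\<rho> \<gamma>)) / of_nat (card R)"
      by (simp add: q_def add_divide_distrib)
    then show ?thesis unfolding *[symmetric] q_def .
  qed
  \<comment> \<open>The translation by \<open>- q\<close> moves the second fixed point to 0 and
    keeps infinity, so the affine maps become multiplications by \<open>a\<close>.\<close>
  define Q where "Q = (vector [vector [1, - q], vector [0, 1]] :: complex^2^2)"
  have Q: "invertible Q" by (simp add: Q_def invertible_det_nz det_2)
  have lQ: "lft Q p = map_option (\<lambda>x. x - q) p" for p
    by (auto simp: Q_def lft_def split: option.splits)
  show ?thesis
  proof (rule that[of "Q ** C" "\<lambda>\<gamma>. a (\<rho> \<gamma>)"])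
    show "invertible (Q ** C)" using Q C(1) by (rule invertible_mult)
    fix \<gamma> p assume \<gamma>: "\<gamma> \<in> ?\<Gamma>"
    have "a (\<rho> \<gamma>) * x + b (\<rho> \<gamma>) - q = a (\<rho> \<gamma>) * (x - q)" for x
      using q[OF \<gamma>] by (simp add: algebra_simps)
    then show "lft (Q ** C) (pgl_act (\<rho> \<gamma>) p) = map_option (\<lambda>x. a (\<rho> \<gamma>) * x) (lft (Q ** C) p)"
      using \<gamma> by (simp add: lft_mult Q C(1) lQ ab(2) option.map_comp o_def)
  qed (use ab(1) am in auto)
qed

text \<open>\<open>S\<inverse> = T (S T S\<inverse>) T\<close> in \<open>SL\<^sub>2(\<int>)\<close>.\<close>
lemma character_S_T:
  fixes \<alpha> :: "int^2^2 \<Rightarrow> complex"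
  assumes nz: "\<And>\<gamma>. \<gamma> \<in> carrier SL2Z \<Longrightarrow> \<alpha> \<gamma> \<noteq> 0"
    and mult: "\<And>\<gamma> \<delta>. \<gamma> \<in> carrier SL2Z \<Longrightarrow> \<delta> \<in> carrier SL2Z \<Longrightarrow> \<alpha> (\<gamma> ** \<delta>) = \<alpha> \<gamma> * \<alpha> \<delta>"
  shows "\<alpha> (vector [vector [0, - 1], vector [1, 0]]) * \<alpha> (vector [vector [1, 1], vector [0, 1]]) ^ 3 = 1"
proof -
  define S where "S = (vector [vector [0, - 1], vector [1, 0]] :: int^2^2)"
  define S' where "S' = (vector [vector [0, 1], vector [- 1, 0]] :: int^2^2)"
  define T where "T = (vector [vector [1, 1], vector [0, 1]] :: int^2^2)"
  have c: "S \<in> carrier SL2Z" "S' \<in> carrier SL2Z" "T \<in> carrier SL2Z"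
    by (simp_all add: S_def S'_def T_def SL2Z_def det_2)
  have mc: "\<gamma> ** \<delta> \<in> carrier SL2Z" if "\<gamma> \<in> carrier SL2Z" "\<delta> \<in> carrier SL2Z" for \<gamma> \<delta>
    using that by (simp add: SL2Z_def det_mul)
  have "S' = T ** (S ** (T ** (S' ** T)))"
    by (simp add: S_def S'_def T_def vec_eq_iff forall_2 matrix_matrix_mult_def sum_2)
  then have "\<alpha> S' = \<alpha> (T ** (S ** (T ** (S' ** T))))" by (rule arg_cong)
  also have "\<dots> = \<alpha> S' * (\<alpha> S * \<alpha> T ^ 3)"
    by (simp add: mult mc c power3_eq_cube mult_ac)
  finally have "\<alpha> S * \<alpha> T ^ 3 = 1" using nz[OF c(2)] by (metis mult_cancel_left2)
  then show ?thesis using nz[OF c(2)] by (simp add: S_def T_def)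
qed

section \<open>The logarithmic derivative of a solution\<close>

text \<open>Here \<open>g\<close> is f/f' for f = (ah + b)/(ch + d). The Schwarzian of f equals that
  of h, and f''/f' = (1 - g')/g turns it into the stated equation. The formula for \<open>g\<close>
  has no denominator ch + d, so a direct computation in \<open>N\<close>, \<open>M\<close> and
  \<open>r\<close> covers the zeros of ch + d as well.\<close>

lemma schwarzian_quadratic_identity:
  fixes a b c d :: complex
  assumes U: "open U" and h: "h holomorphic_on U"
    and h': "\<And>\<tau>. \<tau> \<in> U \<Longrightarrow> deriv h \<tau> \<noteq> 0"
    and det: "a * d - b * c \<noteq> 0"
    and g: "\<And>\<tau>. \<tau> \<in> U \<Longrightarrow> g \<tau> = (a * h \<tau> + b) * (c * h \<tau> + d) / ((a * d - b * c) * deriv h \<tau>)"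
    and \<tau>: "\<tau> \<in> U"
  shows "2 * g \<tau> * deriv (deriv g) \<tau> - (deriv g \<tau>)\<^sup>2 + 2 * schwarzian h \<tau> * (g \<tau>)\<^sup>2 = - 1"
proof -
  define e where "e = 1 / (a * d - b * c)"
  define h1 h2 h3 where "h1 = deriv h" and "h2 = deriv h1" and "h3 = deriv h2"
  define N M where "N = (\<lambda>\<tau>. a * h \<tau> + b)" and "M = (\<lambda>\<tau>. c * h \<tau> + d)"
  define r where "r = (\<lambda>\<tau>. 1 / h1 \<tau>)"
  define g1 where "g1 = (\<lambda>\<tau>. e * (a * M \<tau> + c * N \<tau>) - e * N \<tau> * M \<tau> * h2 \<tau> * (r \<tau>)\<^sup>2)"
  have hol: "h1 holomorphic_on U" "h2 holomorphic_on U"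
    unfolding h1_def h2_def using U h by (auto intro: holomorphic_deriv)
  have D: "(h has_field_derivative h1 \<tau>) (at \<tau>)" "(h1 has_field_derivative h2 \<tau>) (at \<tau>)"
    "(h2 has_field_derivative h3 \<tau>) (at \<tau>)" if "\<tau> \<in> U" for \<tau>
    unfolding h1_def h2_def h3_def
    using holomorphic_derivI[OF h U that] holomorphic_derivI[OF hol(1) U that]
      holomorphic_derivI[OF hol(2) U that] by (simp_all add: h1_def h2_def)
  have DN: "(N has_field_derivative a * h1 \<tau>) (at \<tau>)" "(M has_field_derivative c * h1 \<tau>) (at \<tau>)"
    if "\<tau> \<in> U" for \<tau>
    unfolding N_def M_def using D[OF that] by (auto intro!: derivative_eq_intros)
  have nz: "h1 \<tau> \<noteq> 0" if "\<tau> \<in> U" for \<tau> using h' that by (simp add: h1_def)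
  have rh: "r \<tau> * h1 \<tau> = 1" if "\<tau> \<in> U" for \<tau> using nz[OF that] by (simp add: r_def)
  have Dr: "(r has_field_derivative - h2 \<tau> * (r \<tau>)\<^sup>2) (at \<tau>)" if "\<tau> \<in> U" for \<tau>
    unfolding r_def using D[OF that] nz[OF that]
    by (auto intro!: derivative_eq_intros simp: power2_eq_square)
  have g_eq: "g \<tau> = e * N \<tau> * M \<tau> * r \<tau>" if "\<tau> \<in> U" for \<tau>
    using g[OF that] by (simp add: N_def M_def e_def r_def h1_def)
  have dg: "deriv g \<tau> = g1 \<tau>" if \<tau>: "\<tau> \<in> U" for \<tau>
  proof -
    have "((\<lambda>\<tau>. e * N \<tau> * M \<tau> * r \<tau>) has_field_derivative g1 \<tau>) (at \<tau>)"
      unfolding g1_def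
      by (rule DERIV_cong, (rule DN D Dr \<tau> derivative_intros)+) (use rh[OF \<tau>] in algebra)
    then have "(g has_field_derivative g1 \<tau>) (at \<tau>)"
      using g_eq by (subst has_field_derivative_cong_ev[OF refl, where g = "\<lambda>\<tau>. e * N \<tau> * M \<tau> * r \<tau>"])
        (use eventually_nhds_in_open[OF U \<tau>] in \<open>auto elim: eventually_mono\<close>)
    then show ?thesis by (rule DERIV_imp_deriv)
  qed
  define g2 where "g2 = e * (2 * a * c * h1 \<tau> - (a * M \<tau> + c * N \<tau>) * h2 \<tau> * r \<tau>
      - N \<tau> * M \<tau> * h3 \<tau> * (r \<tau>)\<^sup>2 + 2 * N \<tau> * M \<tau> * (h2 \<tau>)\<^sup>2 * r \<tau> ^ 3)"
  have ddg: "deriv (deriv g) \<tau> = g2"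
  proof -
    have "(g1 has_field_derivative g2) (at \<tau>)"
      unfolding g1_def g2_def
      by (rule DERIV_cong, (rule DN D Dr \<tau> derivative_intros)+)
        (use rh[OF \<tau>] in \<open>simp, algebra\<close>)
    then have "(deriv g has_field_derivative g2) (at \<tau>)"
      by (subst has_field_derivative_cong_ev[OF refl, where g = g1])
        (use eventually_nhds_in_open[OF U \<tau>] dg in \<open>auto elim: eventually_mono\<close>)
    then show ?thesis by (rule DERIV_imp_deriv)
  qed
  have S: "schwarzian h \<tau> = h3 \<tau> * r \<tau> - 3 / 2 * (h2 \<tau> * r \<tau>)\<^sup>2"
    by (simp add: schwarzian_def h1_def h2_def h3_def r_def numeral_2_eq_2 numeral_3_eq_3)
  have G: "g \<tau> = e * N \<tau> * M \<tau> * r \<tau>" by (rule g_eq[OF \<tau>])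
  have G1: "deriv g \<tau> = e * (a * M \<tau> + c * N \<tau>) - e * N \<tau> * M \<tau> * h2 \<tau> * (r \<tau>)\<^sup>2"
    using dg[OF \<tau>] by (simp add: g1_def)
  \<comment> \<open>With p = eaM and q = ecN this reads p - q = 1, and after all terms with second
    and third derivatives cancel there remains 4pq - (p + q)^2 = -(p - q)^2.\<close>
  have "e * (a * M \<tau> - c * N \<tau>) = 1"
    using det by (simp add: e_def M_def N_def algebra_simps)
  then have e1: "e * a * M \<tau> = 1 + e * c * N \<tau>" by (simp add: algebra_simps)
  have "2 * g \<tau> * g2 - (deriv g \<tau>)\<^sup>2 + 2 * schwarzian h \<tau> * (g \<tau>)\<^sup>2
     = 4 * (e * a * M \<tau>) * (e * c * N \<tau>) * (r \<tau> * h1 \<tau>) - (e * a * M \<tau> + e * c * N \<tau>)\<^sup>2"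
    unfolding G G1 S g2_def by (simp add: power2_eq_square power3_eq_cube algebra_simps)
  also have "\<dots> = - 1" unfolding rh[OF \<tau>] e1 by (simp add: power2_eq_square algebra_simps)
  finally show ?thesis unfolding ddg .
qed

section \<open>Absence of poles of g\<close>

text \<open>The quotient rule in a form that iterates: the derivative has the shape of
  \<open>g\<close> again, with the exponent raised by one and an explicit new numerator.\<close>

lemma deriv_divide_power:
  fixes \<phi> :: "complex \<Rightarrow> complex"
  assumes "\<phi> holomorphic_on U" "open U" "w \<in> U" "w \<noteq> z"
    and g: "\<And>w. w \<in> U - {z} \<Longrightarrow> g w = \<phi> w / (w - z) ^ m"
  shows "deriv g w = (deriv \<phi> w * (w - z) - of_nat m * \<phi> w) / (w - z) ^ Suc m"
proof -
  have d: "(\<phi> has_field_derivative deriv \<phi> w) (at w)"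
    using assms by (intro holomorphic_derivI)
  have "((\<lambda>w. \<phi> w / (w - z) ^ m) has_field_derivative
      (deriv \<phi> w * (w - z) - of_nat m * \<phi> w) / (w - z) ^ Suc m) (at w)"
  proof (cases m)
    case 0
    then show ?thesis using assms(4) d by simp
  next
    case (Suc k)
    have *: "(A * t ^ Suc k - B * (c * t ^ k)) / (t ^ Suc k * t ^ Suc k)
        = (A * t - c * B) / t ^ Suc (Suc k)" if "t \<noteq> 0" for A B c t :: complex
      using that by (simp add: field_simps)
    have "((\<lambda>w. (w - z) ^ m) has_field_derivative of_nat m * (w - z) ^ k) (at w)"
    proof -
      have "((\<lambda>w. w - z) has_field_derivative 1) (at w)"
        by (auto intro!: derivative_eq_intros)
      from DERIV_power_Suc[OF this, of k] show ?thesis by (simp add: Suc)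
    qed
    from DERIV_divide[OF d this] show ?thesis using assms(4) Suc *[of "w - z"] by simp
  qed
  moreover have "\<forall>\<^sub>F w in nhds w. g w = \<phi> w / (w - z) ^ m"
  proof (rule eventually_mono)
    show "\<forall>\<^sub>F w in nhds w. w \<in> U - {z}"
      using assms by (intro eventually_nhds_in_open open_Diff) auto
  qed (rule g)
  ultimately have "(g has_field_derivative
      (deriv \<phi> w * (w - z) - of_nat m * \<phi> w) / (w - z) ^ Suc m) (at w)"
    by (simp add: has_field_derivative_cong_ev[OF refl])
  then show ?thesis by (rule DERIV_imp_deriv)
qed

text \<open>At a pole of order \<open>n\<close> of \<open>g\<close> the left-hand side would have a pole of order \<open>2n + 2\<close>
  with leading coefficient proportional to \<open>n\<^sup>2 + 2n\<close>.\<close>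
lemma product_equation_no_pole:
  assumes mero: "g meromorphic_on {z}" and S: "isCont S z"
    and eq: "\<forall>\<^sub>F w in at z. 2 * g w * deriv (deriv g) w - (deriv g w)\<^sup>2 + 2 * S w * (g w)\<^sup>2 = - 1"
  shows "\<not> is_pole g z"
proof
  assume pole: "is_pole g z"
  have "isolated_singularity_at g z" using mero by (simp add: meromorphic_at_iff)
  then obtain r0 where r0: "r0 > 0" "g analytic_on ball z r0 - {z}"
    unfolding isolated_singularity_at_def by blast
  define n where "n = nat (- zorder g z)"
  define \<phi> where "\<phi> = zor_poly g z"
  obtain r where r: "r > 0" "\<phi> holomorphic_on cball z r" "\<phi> z \<noteq> 0" "zorder g z < 0"
    "\<And>w. w \<in> cball z r - {z} \<Longrightarrow> g w = \<phi> w / (w - z) ^ n"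
    using zorder_exist_pole[OF analytic_imp_holomorphic[OF r0(2)] open_ball _ pole] r0(1)
    unfolding n_def \<phi>_def by auto
  let ?U = "ball z r"
  have n: "n > 0" using r(4) by (simp add: n_def)
  have \<phi>: "\<phi> holomorphic_on ?U" using r(2) by (rule holomorphic_on_subset) auto
  define \<phi>1 where "\<phi>1 = (\<lambda>w. deriv \<phi> w * (w - z) - of_nat n * \<phi> w)"
  define \<phi>2 where "\<phi>2 = (\<lambda>w. deriv \<phi>1 w * (w - z) - of_nat (Suc n) * \<phi>1 w)"
  have \<phi>1: "\<phi>1 holomorphic_on ?U" unfolding \<phi>1_def by (intro holomorphic_intros \<phi> holomorphic_deriv) auto
  have \<phi>2: "\<phi>2 holomorphic_on ?U" unfolding \<phi>2_def by (intro holomorphic_intros \<phi>1 holomorphic_deriv) auto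
  have g0: "g w = \<phi> w / (w - z) ^ n" if "w \<in> ?U - {z}" for w using r(5) that by auto
  have g1: "deriv g w = \<phi>1 w / (w - z) ^ Suc n" if "w \<in> ?U - {z}" for w
    unfolding \<phi>1_def using that by (intro deriv_divide_power[OF \<phi> open_ball] g0) auto
  have g2: "deriv (deriv g) w = \<phi>2 w / (w - z) ^ Suc (Suc n)" if "w \<in> ?U - {z}" for w
    unfolding \<phi>2_def using that by (intro deriv_divide_power[OF \<phi>1 open_ball] g1) auto
  \<comment> \<open>This is the equation multiplied by \<open>(w - z) ^ (2 * n + 2)\<close>, with
    the constant brought to the left. It is continuous at \<open>z\<close> and vanishes on a
    punctured neighbourhood.\<close>
  define \<Psi> where "\<Psi> = (\<lambda>w. 2 * \<phi> w * \<phi>2 w - (\<phi>1 w)\<^sup>2 + 2 * S w * (\<phi> w)\<^sup>2 * (w - z)\<^sup>2 + (w - z) ^ (2 * n + 2))"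
  have "\<forall>\<^sub>F w in at z. w \<in> ?U - {z}"
    using r(1) by (intro eventually_at_in_open) auto
  then have "\<forall>\<^sub>F w in at z. \<Psi> w = 0" using eq
  proof eventually_elim
    case (elim w)
    define t where "t = w - z"
    have t: "t \<noteq> 0" using elim by (simp add: t_def)
    have "2 * (\<phi> w / t ^ n) * (\<phi>2 w / t ^ Suc (Suc n)) - (\<phi>1 w / t ^ Suc n)\<^sup>2
        + 2 * S w * (\<phi> w / t ^ n)\<^sup>2 = - 1"
      using elim(2) g0[OF elim(1)] g1[OF elim(1)] g2[OF elim(1)] by (simp add: t_def)
    then have "(2 * (\<phi> w / t ^ n) * (\<phi>2 w / t ^ Suc (Suc n)) - (\<phi>1 w / t ^ Suc n)\<^sup>2
        + 2 * S w * (\<phi> w / t ^ n)\<^sup>2) * t ^ (2 * n + 2) = - (t ^ (2 * n + 2))" by simp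
    moreover have "t ^ (2 * n + 2) = t ^ n * t ^ Suc (Suc n)" "t ^ (2 * n + 2) = (t ^ Suc n)\<^sup>2"
      "t ^ (2 * n + 2) = (t ^ n)\<^sup>2 * t\<^sup>2"
      by (simp_all add: power_add power_mult power2_eq_square mult_ac flip: power_mult_distrib)
    moreover have "(2 * (\<phi> w / t ^ n) * (\<phi>2 w / t ^ Suc (Suc n))) * (t ^ n * t ^ Suc (Suc n)) = 2 * \<phi> w * \<phi>2 w"
      "(\<phi>1 w / t ^ Suc n)\<^sup>2 * (t ^ Suc n)\<^sup>2 = (\<phi>1 w)\<^sup>2"
      "(2 * S w * (\<phi> w / t ^ n)\<^sup>2) * ((t ^ n)\<^sup>2 * t\<^sup>2) = 2 * S w * (\<phi> w)\<^sup>2 * t\<^sup>2"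
      using t by (simp_all add: power_divide)
    ultimately have "2 * \<phi> w * \<phi>2 w - (\<phi>1 w)\<^sup>2 + 2 * S w * (\<phi> w)\<^sup>2 * t\<^sup>2 = - (t ^ (2 * n + 2))"
      by (metis (no_types, lifting) distrib_right left_diff_distrib)
    then show ?case by (simp add: \<Psi>_def t_def)
  qed
  then have "\<Psi> \<midarrow>z\<rightarrow> 0" by (rule tendsto_eventually)
  moreover have "\<Psi> \<midarrow>z\<rightarrow> \<Psi> z"
  proof -
    have "isCont \<phi> z" "isCont \<phi>1 z" "isCont \<phi>2 z"
      using \<phi> \<phi>1 \<phi>2 r(1) holomorphic_on_imp_continuous_on continuous_on_interior
      by (metis centre_in_ball interior_open open_ball)+
    then show ?thesis unfolding \<Psi>_def using S
      by (intro isContD) (intro continuous_intros)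
  qed
  ultimately have "\<Psi> z = 0" using LIM_unique by blast
  \<comment> \<open>At \<open>z\<close> the numerators are \<phi>1 = -n \<phi> and \<phi>2 = n(n +
    1) \<phi>, and 2n(n + 1) - n^2 = n(n + 2).\<close>
  then have "of_nat (n * (n + 2)) * (\<phi> z)\<^sup>2 = 0"
    by (simp add: \<Psi>_def \<phi>1_def \<phi>2_def power2_eq_square algebra_simps)
  then show False using n r(3) by (simp del: of_nat_mult of_nat_add)
qed

text \<open>A meromorphic function on a connected open set that takes a value on more than a sparse
  set is constant up to sparse exceptions. For the derivative and the value 0 this would make
  \<open>h\<close> equal to one constant off a sparse set, although \<open>h\<close> avoids each
  value off a sparse set.\<close>

lemma deriv_nonzero_cosparse:
  assumes h: "h nicely_meromorphic_on A" and A: "open A" "connected A" "A \<noteq> {}"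
    and nc: "\<not> h constant_on A"
  shows "\<forall>\<^sub>\<approx>\<tau>\<in>A. deriv h \<tau> \<noteq> 0" and "\<forall>\<^sub>\<approx>\<tau>\<in>A. h \<tau> \<noteq> v"
proof -
  show av: "\<forall>\<^sub>\<approx>\<tau>\<in>A. h \<tau> \<noteq> v" for v
    using nicely_meromorphic_imp_constant_or_avoid[OF h A(1,2), of v] nc
    unfolding constant_on_def by blast
  have m: "h meromorphic_on A" using h by (simp add: nicely_meromorphic_on_def)
  show "\<forall>\<^sub>\<approx>\<tau>\<in>A. deriv h \<tau> \<noteq> 0"
  proof (rule ccontr)
    assume "\<not> (\<forall>\<^sub>\<approx>\<tau>\<in>A. deriv h \<tau> \<noteq> 0)"
    then have d0: "\<forall>\<^sub>\<approx>\<tau>\<in>A. deriv h \<tau> = 0"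
      using meromorphic_imp_constant_or_avoid[OF meromorphic_on_deriv[OF m] A(1,2)] by blast
    have "\<forall>\<^sub>\<approx>\<tau>\<in>A. h analytic_on {\<tau>} \<and> deriv h \<tau> = 0"
      using meromorphic_on_imp_analytic_cosparse[OF m] d0 by (rule eventually_conj)
    then have sp: "{\<tau>. \<not> (h analytic_on {\<tau>} \<and> deriv h \<tau> = 0)} sparse_in A"
      by (simp add: eventually_cosparse)
    \<comment> \<open>Removing a sparse set from a connected open set of the plane leaves it
      connected, so the vanishing derivative yields a single constant.\<close>
    let ?U = "A - {\<tau>. \<not> (h analytic_on {\<tau>} \<and> deriv h \<tau> = 0)}"
    have U: "open ?U" "connected ?U"
      using open_diff_sparse_pts[OF A(1) sp] sparse_imp_connected[OF _ A(2,1) sp] by auto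
    have "\<exists>c. \<forall>\<tau>\<in>?U. h \<tau> = c"
    proof -
      have der: "(h has_field_derivative 0) (at \<tau>)" if "\<tau> \<in> ?U" for \<tau>
        using that analytic_on_imp_differentiable_at[of h "{\<tau>}" \<tau>]
        by (auto simp: DERIV_deriv_iff_field_differentiable[symmetric])
      have cont: "continuous_on ?U h"
        using der by (meson DERIV_isCont continuous_at_imp_continuous_on)
      show ?thesis
        by (rule DERIV_zero_connected_constant[OF U(2,1) finite.emptyI cont]) (use der in blast)+
    qed
    then obtain c where c: "\<And>\<tau>. \<tau> \<in> ?U \<Longrightarrow> h \<tau> = c" by blast
    have "\<forall>\<^sub>\<approx>\<tau>\<in>A. \<tau> \<in> A" using A(1) by (simp add: eventually_in_cosparse)
    then have "\<forall>\<^sub>\<approx>\<tau>\<in>A. False"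
      using av[of c] eventually_not_in_cosparse[OF sp] by eventually_elim (use c in auto)
    then show False using A(3) by (simp add: eventually_False)
  qed
qed

text \<open>The identities are first proved on \<open>U\<close>, where everything is analytic and
  finite. The equation there excludes poles of \<open>g\<close>, which makes \<open>g\<close>
  holomorphic on the whole half-plane, and continuity then carries the equation over.\<close>

lemma schwarzian_solution_logarithmic_derivative:
  fixes D :: "complex^2^2"
  assumes sol: "schwarzian_solution s h" and D: "invertible D"
  obtains g f U where "g holomorphic_on upper_half_plane"
    "\<And>\<tau>. \<tau> \<in> upper_half_plane \<Longrightarrow>
       2 * g \<tau> * deriv (deriv g) \<tau> - (deriv g \<tau>)\<^sup>2 + 2 * (s * E4 \<tau>) * (g \<tau>)\<^sup>2 = - 1"
    "f meromorphic_on upper_half_plane" "f holomorphic_on U" "open U" "U \<subseteq> upper_half_plane"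
    "\<And>\<tau>. \<tau> \<in> upper_half_plane \<Longrightarrow> \<forall>\<^sub>F w in at \<tau>. w \<in> U"
    "\<And>\<tau>. \<tau> \<in> U \<Longrightarrow> lft D (P1_value h \<tau>) = Some (f \<tau>)"
    "\<And>\<tau>. \<tau> \<in> U \<Longrightarrow> deriv f \<tau> \<noteq> 0"
    "\<And>\<tau>. \<tau> \<in> U \<Longrightarrow> f \<tau> = g \<tau> * deriv f \<tau>"
proof -
  let ?H = upper_half_plane
  define a b c d where "a = D$1$1" and "b = D$1$2" and "c = D$2$1" and "d = D$2$2"
  have det: "a * d - b * c \<noteq> 0"
    using D by (simp add: invertible_det_nz det_2 a_def b_def c_def d_def)
  have h: "h nicely_meromorphic_on ?H" "\<not> h constant_on ?H" and
    eq: "\<And>\<tau>. \<tau> \<in> ?H \<Longrightarrow> \<not> is_pole h \<tau> \<Longrightarrow> deriv h \<tau> \<noteq> 0 \<Longrightarrow> schwarzian h \<tau> = s * E4 \<tau>"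
    using sol by (auto simp: schwarzian_solution_def)
  have m: "h meromorphic_on ?H" using h by (simp add: nicely_meromorphic_on_def)
  have ne: "?H \<noteq> {}" by (auto simp: upper_half_plane_def intro: exI[of _ \<i>])
  note H = open_upper_half_plane connected_upper_half_plane
  \<comment> \<open>The exceptions are the poles of \<open>h\<close>, the zeros of
    \<open>deriv h\<close> and the poles of \<open>f\<close>. They are sparse, so \<open>U\<close>
    contains a punctured neighbourhood of every point of the half-plane.\<close>
  define good where "good = (\<lambda>\<tau>. h analytic_on {\<tau>} \<and> deriv h \<tau> \<noteq> 0 \<and> c * h \<tau> + d \<noteq> 0)"
  have "\<forall>\<^sub>\<approx>\<tau>\<in>?H. c * h \<tau> + d \<noteq> 0"
  proof (cases "c = 0")
    case True
    then show ?thesis using det by simp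
  next
    case False
    have "\<forall>\<^sub>\<approx>\<tau>\<in>?H. h \<tau> \<noteq> - d / c" by (rule deriv_nonzero_cosparse(2)[OF h(1) H ne h(2)])
    then show ?thesis
      by eventually_elim (use False in \<open>auto simp: field_simps add_eq_0_iff2\<close>)
  qed
  then have good: "\<forall>\<^sub>\<approx>\<tau>\<in>?H. good \<tau>"
    unfolding good_def
    using meromorphic_on_imp_analytic_cosparse[OF m] deriv_nonzero_cosparse(1)[OF h(1) H ne h(2)]
    by (intro eventually_conj)
  define U where "U = ?H - {\<tau>. \<not> good \<tau>}"
  have U: "open U" "U \<subseteq> ?H"
    unfolding U_def using open_diff_sparse_pts[OF H(1)] good by (auto simp: eventually_cosparse)
  have evU: "\<forall>\<^sub>F w in at \<tau>. w \<in> U" if "\<tau> \<in> ?H" for \<tau>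
    using eventually_cosparse_imp_eventually_at[OF good that] eventually_at_in_open'[OF H(1) that]
    by eventually_elim (auto simp: U_def)
  have Ug: "h analytic_on {\<tau>}" "deriv h \<tau> \<noteq> 0" "c * h \<tau> + d \<noteq> 0" "\<tau> \<in> ?H" if "\<tau> \<in> U" for \<tau>
    using that by (auto simp: U_def good_def)
  have hU: "h holomorphic_on U"
    using Ug(1) analytic_imp_holomorphic analytic_on_analytic_at by blast
  define f where "f = (\<lambda>\<tau>. (a * h \<tau> + b) / (c * h \<tau> + d))"
  define g0 where "g0 = (\<lambda>\<tau>. (a * h \<tau> + b) * (c * h \<tau> + d) / ((a * d - b * c) * deriv h \<tau>))"
  define g where "g = remove_sings g0"
  have fm: "f meromorphic_on ?H" unfolding f_def by (intro meromorphic_intros m)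
  have g0m: "g0 meromorphic_on ?H" unfolding g0_def by (intro meromorphic_intros m)
  have gn: "g nicely_meromorphic_on ?H" unfolding g_def by (rule remove_sings_nicely_meromorphic[OF g0m])
  have gU: "g \<tau> = (a * h \<tau> + b) * (c * h \<tau> + d) / ((a * d - b * c) * deriv h \<tau>)" if "\<tau> \<in> U" for \<tau>
  proof -
    have "g0 holomorphic_on U" unfolding g0_def
      using Ug det by (intro holomorphic_intros hU U holomorphic_deriv) auto
    then have "g0 analytic_on {\<tau>}" using U that by (simp add: analytic_at) blast
    then show ?thesis by (simp add: g_def g0_def)
  qed
  define \<Phi> where "\<Phi> = (\<lambda>\<tau>. 2 * g \<tau> * deriv (deriv g) \<tau> - (deriv g \<tau>)\<^sup>2 + 2 * (s * E4 \<tau>) * (g \<tau>)\<^sup>2)"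
  have \<Phi>U: "\<Phi> \<tau> = - 1" if "\<tau> \<in> U" for \<tau>
    using schwarzian_quadratic_identity[OF U(1) hU Ug(2) det gU that]
      eq[OF Ug(4)[OF that] analytic_at_imp_no_pole[OF Ug(1)[OF that]] Ug(2)[OF that]]
    by (simp add: \<Phi>_def)
  have np: "\<not> is_pole g \<tau>" if \<tau>: "\<tau> \<in> ?H" for \<tau>
  proof (rule product_equation_no_pole[of g \<tau> "\<lambda>\<tau>. s * E4 \<tau>"])
    show "g meromorphic_on {\<tau>}" using gn \<tau> meromorphic_on_subset by (auto simp: nicely_meromorphic_on_def)
    have "isCont E4 \<tau>" using holomorphic_on_E4 \<tau> H(1)
      by (metis continuous_on_eq_continuous_at holomorphic_on_imp_continuous_on)
    then show "isCont (\<lambda>\<tau>. s * E4 \<tau>) \<tau>" by (intro continuous_intros)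
    show "\<forall>\<^sub>F w in at \<tau>. 2 * g w * deriv (deriv g) w - (deriv g w)\<^sup>2 + 2 * (s * E4 w) * (g w)\<^sup>2 = - 1"
      using evU[OF \<tau>] by eventually_elim (use \<Phi>U in \<open>simp add: \<Phi>_def\<close>)
  qed
  then have gH: "g holomorphic_on ?H"
    using nicely_meromorphic_without_singularities[OF gn] analytic_imp_holomorphic by blast
  show ?thesis
  proof (rule that[of g f U])
    show "2 * g \<tau> * deriv (deriv g) \<tau> - (deriv g \<tau>)\<^sup>2 + 2 * (s * E4 \<tau>) * (g \<tau>)\<^sup>2 = - 1"
      if \<tau>: "\<tau> \<in> ?H" for \<tau>
    proof -
      have "\<Phi> holomorphic_on ?H" unfolding \<Phi>_def
        by (intro holomorphic_intros gH holomorphic_deriv H(1) holomorphic_on_E4)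
      then have "isCont \<Phi> \<tau>" using \<tau> H(1)
        by (metis continuous_on_eq_continuous_at holomorphic_on_imp_continuous_on)
      then have "\<Phi> \<midarrow>\<tau>\<rightarrow> \<Phi> \<tau>" by (rule isContD)
      moreover have "\<Phi> \<midarrow>\<tau>\<rightarrow> - 1"
        by (rule tendsto_eventually) (use evU[OF \<tau>] \<Phi>U in \<open>auto elim: eventually_mono\<close>)
      ultimately show ?thesis using LIM_unique unfolding \<Phi>_def by blast
    qed
    show "f holomorphic_on U" unfolding f_def using Ug by (intro holomorphic_intros hU) auto
    fix \<tau> assume \<tau>: "\<tau> \<in> U"
    have df: "deriv f \<tau> = (a * d - b * c) * deriv h \<tau> / (c * h \<tau> + d)\<^sup>2"
    proof (rule DERIV_imp_deriv)
      have "(h has_field_derivative deriv h \<tau>) (at \<tau>)" by (rule holomorphic_derivI[OF hU U(1) \<tau>])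
      then show "(f has_field_derivative (a * d - b * c) * deriv h \<tau> / (c * h \<tau> + d)\<^sup>2) (at \<tau>)"
        unfolding f_def using Ug(3)[OF \<tau>]
        by (auto intro!: derivative_eq_intros simp: power2_eq_square) (simp add: algebra_simps)
    qed
    then show "deriv f \<tau> \<noteq> 0" using Ug[OF \<tau>] det by simp
    show "f \<tau> = g \<tau> * deriv f \<tau>"
      using Ug[OF \<tau>] det unfolding df gU[OF \<tau>] by (simp add: f_def power2_eq_square)
    show "lft D (P1_value h \<tau>) = Some (f \<tau>)"
      using Ug[OF \<tau>] analytic_at_imp_no_pole[OF Ug(1)[OF \<tau>]]
      by (simp add: P1_value_def lft_def f_def a_def b_def c_def d_def)
  qed (use gH fm U evU in auto)
qed

section \<open>Multipliers\<close>

lemma holomorphic_isCont: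
  "f holomorphic_on A \<Longrightarrow> open A \<Longrightarrow> z \<in> A \<Longrightarrow> isCont f z"
  by (metis continuous_on_eq_continuous_at holomorphic_on_imp_continuous_on)

lemma eventually_eq_imp_eq:
  fixes F G :: "complex \<Rightarrow> complex"
  assumes "isCont F z" "isCont G z" "\<forall>\<^sub>F w in at z. F w = G w"
  shows "F z = G z"
proof -
  have "F \<midarrow>z\<rightarrow> F z" "G \<midarrow>z\<rightarrow> G z" using assms(1,2) by (auto dest: isContD)
  moreover have "F \<midarrow>z\<rightarrow> G z" using tendsto_cong[OF assms(3)] calculation(2) by blast
  ultimately show ?thesis using LIM_unique by blast
qed

text \<open>Differentiating f(m \<tau>) = a f(\<tau>) gives f'(m \<tau>) m'(\<tau>) = a f'(\<tau>).
  In the quotient g = f/f' the multiplier \<open>a\<close> cancels and only m' remains; continuity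
  extends this beyond \<open>U\<close>.\<close>

lemma semi_invariant_imp_weight:
  assumes H: "open H" and U: "open U" "U \<subseteq> H" and evU: "\<And>\<tau>. \<tau> \<in> H \<Longrightarrow> \<forall>\<^sub>F w in at \<tau>. w \<in> U"
    and g: "g holomorphic_on H" and f: "f holomorphic_on U"
    and fg: "\<And>\<tau>. \<tau> \<in> U \<Longrightarrow> deriv f \<tau> \<noteq> 0" "\<And>\<tau>. \<tau> \<in> U \<Longrightarrow> f \<tau> = g \<tau> * deriv f \<tau>"
    and m: "\<And>\<tau>. \<tau> \<in> H \<Longrightarrow> (m has_field_derivative m' \<tau>) (at \<tau>)" "m ` H \<subseteq> H" "inj_on m H"
    and m': "continuous_on H m'"
    and a: "a \<noteq> 0" "\<And>\<tau>. \<tau> \<in> U \<Longrightarrow> m \<tau> \<in> U \<Longrightarrow> f (m \<tau>) = a * f \<tau>"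
    and \<tau>: "\<tau> \<in> H"
  shows "\<forall>\<^sub>F w in at \<tau>. w \<in> U \<and> m w \<in> U" and "g (m \<tau>) = m' \<tau> * g \<tau>"
proof -
  have mc: "isCont m z" if "z \<in> H" for z using m(1)[OF that] by (rule DERIV_isCont)
  show ev: "\<forall>\<^sub>F w in at \<tau>. w \<in> U \<and> m w \<in> U"
  proof -
    have inH: "\<forall>\<^sub>F w in at \<tau>. w \<in> H - {\<tau>}"
      using H \<tau> by (intro eventually_at_in_open) auto
    \<comment> \<open>Injectivity makes \<open>m\<close> map punctured neighbourhoods into punctured
      ones, where \<open>U\<close> is known to hold.\<close>
    have "filterlim m (at (m \<tau>)) (at \<tau>)"
      unfolding filterlim_at
    proof
      show "\<forall>\<^sub>F w in at \<tau>. m w \<in> UNIV \<and> m w \<noteq> m \<tau>"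
        using inH by eventually_elim (use m(3) \<tau> in \<open>auto simp: inj_on_def\<close>)
    qed (use mc[OF \<tau>] in \<open>rule isContD\<close>)
    moreover have "\<forall>\<^sub>F w in at (m \<tau>). w \<in> U" using evU m(2) \<tau> by blast
    ultimately have "\<forall>\<^sub>F w in at \<tau>. m w \<in> U" by (rule eventually_compose_filterlim[rotated])
    then show ?thesis using evU[OF \<tau>] by eventually_elim auto
  qed
  have eq: "g (m w) = m' w * g w" if w: "w \<in> U" "m w \<in> U" for w
  proof -
    have wH: "w \<in> H" using w U by blast
    have "(f has_field_derivative deriv f w) (at w)" "(f has_field_derivative deriv f (m w)) (at (m w))"
      using holomorphic_derivI[OF f U(1)] w by auto
    then have d1: "((\<lambda>w. a * f w) has_field_derivative a * deriv f w) (at w)"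
      and d2: "((\<lambda>w. f (m w)) has_field_derivative deriv f (m w) * m' w) (at w)"
      using DERIV_chain2[OF _ m(1)[OF wH]] by (auto intro: DERIV_cmult)
    have "\<forall>\<^sub>F y in nhds w. y \<in> U" using U(1) w(1) by (rule eventually_nhds_in_open)
    moreover have "\<forall>\<^sub>F y in nhds w. m y \<in> U"
      using mc[OF wH] topological_tendstoD[of m "m w" "nhds w" U] U(1) w(2)
      by (simp add: isCont_def tendsto_at_iff_tendsto_nhds)
    ultimately have "\<forall>\<^sub>F y in nhds w. f (m y) = a * f y"
      by eventually_elim (use a(2) in auto)
    then have "((\<lambda>w. f (m w)) has_field_derivative a * deriv f w) (at w)"
      using d1 by (simp add: has_field_derivative_cong_ev[OF refl])
    then have "deriv f (m w) * m' w = a * deriv f w" using d2 by (rule DERIV_unique[symmetric])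
    \<comment> \<open>\<open>f\<close> may vanish on \<open>U\<close>, so the factor to be cancelled
      is its derivative, which does not.\<close>
    then have "deriv f (m w) * (m' w * g w) = a * f w" using fg(2)[OF w(1)] by (metis mult.assoc mult.commute)
    also have "\<dots> = deriv f (m w) * g (m w)" using a(2)[OF w] fg(2)[OF w(2)] by (simp add: mult.commute)
    finally show ?thesis using fg(1)[OF w(2)] by simp
  qed
  have cg: "isCont g z" if "z \<in> H" for z using holomorphic_isCont[OF g H that] .
  show "g (m \<tau>) = m' \<tau> * g \<tau>"
  proof (rule eventually_eq_imp_eq[where F = "\<lambda>\<tau>. g (m \<tau>)" and G = "\<lambda>\<tau>. m' \<tau> * g \<tau>"])
    show "isCont (\<lambda>\<tau>. g (m \<tau>)) \<tau>"
      using m(2) \<tau> by (intro isCont_o2[OF mc[OF \<tau>] cg]) auto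
    show "isCont (\<lambda>\<tau>. m' \<tau> * g \<tau>) \<tau>"
      using m' H \<tau> cg[OF \<tau>] by (intro continuous_intros) (auto simp: continuous_on_eq_continuous_at)
    show "\<forall>\<^sub>F w in at \<tau>. g (m w) = m' w * g w"
      using ev by eventually_elim (use eq in auto)
  qed
qed

text \<open>Near the cusp \<open>f'/f = 1/g\<close> is uniformly small, so \<open>f (\<tau> + 1) / f \<tau>\<close>, the exponential of
  its integral, is close to \<open>1\<close>.\<close>
lemma translation_multiplier_eq_1:
  assumes U: "open U" and evU: "\<And>\<tau>. Im \<tau> > 0 \<Longrightarrow> \<forall>\<^sub>F w in at \<tau>. w \<in> U \<and> w + 1 \<in> U"
    and g: "g holomorphic_on {\<tau>. Im \<tau> > 0}" and f: "f holomorphic_on U"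
    and fg: "\<And>\<tau>. \<tau> \<in> U \<Longrightarrow> deriv f \<tau> \<noteq> 0" "\<And>\<tau>. \<tau> \<in> U \<Longrightarrow> f \<tau> = g \<tau> * deriv f \<tau>"
    and a: "\<And>\<tau>. \<tau> \<in> U \<Longrightarrow> \<tau> + 1 \<in> U \<Longrightarrow> f (\<tau> + 1) = a * f \<tau>"
    and small: "\<And>\<epsilon>. \<epsilon> > 0 \<Longrightarrow> \<exists>Y\<ge>0. \<forall>\<tau>. Im \<tau> > Y \<longrightarrow> g \<tau> \<noteq> 0 \<and> norm (1 / g \<tau>) \<le> \<epsilon>"
  shows "a = 1"
proof (rule ccontr)
  assume a1: "a \<noteq> 1"
  have "isCont exp (0 :: complex)" by simp
  then obtain \<epsilon> where \<epsilon>: "\<epsilon> > 0" "\<And>\<delta> :: complex. norm \<delta> < \<epsilon> \<Longrightarrow> dist (exp \<delta>) 1 < dist a 1"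
    using a1 unfolding continuous_at_eps_delta dist_norm by (metis diff_zero exp_zero zero_less_norm_iff right_minus_eq)
  obtain Y where Y: "Y \<ge> 0" "\<And>\<tau>. Im \<tau> > Y \<Longrightarrow> g \<tau> \<noteq> 0" "\<And>\<tau>. Im \<tau> > Y \<Longrightarrow> norm (1 / g \<tau>) \<le> \<epsilon> / 2"
    using small[of "\<epsilon> / 2"] \<epsilon>(1) by auto
  define V where "V = {\<tau>. Im \<tau> > Y}"
  have V: "open V" "convex V" unfolding V_def by (rule open_halfspace_Im_gt convex_halfspace_Im_gt)+
  have ghol: "(\<lambda>\<tau>. 1 / g \<tau>) holomorphic_on V"
    using Y by (intro holomorphic_intros holomorphic_on_subset[OF g]) (auto simp: V_def)
  then obtain L where L: "\<And>\<tau>. \<tau> \<in> V \<Longrightarrow> (L has_field_derivative 1 / g \<tau>) (at \<tau>)"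
    using holomorphic_convex_primitive'[OF V(2,1) ghol] V(1) by (metis at_within_open)
  have evV: "\<forall>\<^sub>F w in at \<tau>. w \<in> U" if "\<tau> \<in> V" for \<tau>
    using evU[of \<tau>] that Y(1) by (auto simp: V_def elim: eventually_mono)
  \<comment> \<open>\<open>V - - U\<close> is the part of \<open>V\<close> inside \<open>U\<close>.
    It is connected because only a sparse set is missing, so \<open>f * exp (- L)\<close>, whose
    derivative vanishes, is a single constant on it.\<close>
  then have sp: "- U sparse_in V" by (simp add: sparse_in_eventually_iff[OF V(1)])
  have W: "open (V - - U)" "connected (V - - U)"
    using open_diff_sparse_pts[OF V(1) sp] sparse_imp_connected[OF _ convex_connected[OF V(2)] V(1) sp] by auto
  define F where "F = (\<lambda>\<tau>. f \<tau> * exp (- L \<tau>))"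
  have dF: "(F has_field_derivative 0) (at \<tau>)" if \<tau>: "\<tau> \<in> V - - U" for \<tau>
  proof -
    have "(f has_field_derivative deriv f \<tau>) (at \<tau>)" using \<tau> by (intro holomorphic_derivI[OF f U]) auto
    then have "(F has_field_derivative (deriv f \<tau> - f \<tau> * (1 / g \<tau>)) * exp (- L \<tau>)) (at \<tau>)"
      unfolding F_def using L[of \<tau>] \<tau> by (auto intro!: derivative_eq_intros simp: algebra_simps)
    moreover have "deriv f \<tau> - f \<tau> * (1 / g \<tau>) = 0"
      using fg(2)[of \<tau>] Y(2)[of \<tau>] \<tau> by (simp add: V_def)
    ultimately show ?thesis by simp
  qed
  have cont: "continuous_on (V - - U) F" using dF by (meson DERIV_isCont continuous_at_imp_continuous_on)
  obtain K where K: "\<And>\<tau>. \<tau> \<in> V - - U \<Longrightarrow> F \<tau> = K"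
    by (rule DERIV_zero_connected_constant[OF W(2,1) finite.emptyI cont]) (use dF in blast)+
  have "\<forall>\<^sub>F w in at (\<i> * of_real (Y + 1)). (w \<in> U \<and> w + 1 \<in> U) \<and> w \<in> V"
    using Y(1) by (intro eventually_conj evU eventually_at_in_open'[OF V(1)]) (auto simp: V_def)
  then obtain w where w: "w \<in> U" "w + 1 \<in> U" "w \<in> V"
    using eventually_happens'[OF at_neq_bot] by blast
  have w1: "w + 1 \<in> V" using w by (simp add: V_def)
  have "F (w + 1) = F w" using K[of w] K[of "w + 1"] w w1 by simp
  then have "a * f w * exp (- L (w + 1)) = f w * exp (- L w)" using a[OF w(1,2)] by (simp add: F_def)
  moreover have "f w \<noteq> 0" using fg[OF w(1)] Y(2)[of w] w(3) by (simp add: V_def)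
  ultimately have "a = exp (L (w + 1) - L w)"
    by (simp add: exp_diff exp_minus field_simps)
  \<comment> \<open>The mean value inequality on the convex set \<open>V\<close>, over a translation
    of length 1. The bound \<open>\<epsilon> / 2\<close> leaves the strict inequality needed for
    \<open>\<epsilon>\<close>.\<close>
  moreover have "norm (L (w + 1) - L w) \<le> \<epsilon> / 2 * norm (w + 1 - w)"
  proof (rule field_differentiable_bound[OF V(2), of L "\<lambda>\<tau>. 1 / g \<tau>"])
    show "(L has_field_derivative 1 / g z) (at z within V)" if "z \<in> V" for z
      using L[OF that] by (rule has_field_derivative_at_within)
    show "norm (1 / g z) \<le> \<epsilon> / 2" if "z \<in> V" for z
      using Y(3)[of z] that by (simp add: V_def)
  qed (use w(3) w1 in auto)
  ultimately show False using \<epsilon>(2)[of "L (w + 1) - L w"] \<epsilon>(1) by simp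
qed

text \<open>\<open>g\<close> has a simple zero at \<open>\<i>\<close> with derivative \<open>\<plusminus>1\<close>, so \<open>f\<close> has order \<open>\<plusminus>1\<close> there, while
  \<open>\<tau> \<mapsto> - 1 / \<tau>\<close> has derivative \<open>- 1\<close> at its fixed point \<open>\<i>\<close>.\<close>
lemma inversion_multiplier_eq_minus_1:
  assumes evU: "\<forall>\<^sub>F w in at \<i>. w \<in> U \<and> - 1 / w \<in> U"
    and g: "g holomorphic_on {\<tau>. Im \<tau> > 0}" "g \<i> = 0" "(deriv g \<i>)\<^sup>2 = 1"
    and f: "f meromorphic_on {\<i>}"
    and fg: "\<And>\<tau>. \<tau> \<in> U \<Longrightarrow> deriv f \<tau> \<noteq> 0" "\<And>\<tau>. \<tau> \<in> U \<Longrightarrow> f \<tau> = g \<tau> * deriv f \<tau>"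
    and c: "\<And>\<tau>. \<tau> \<in> U \<Longrightarrow> - 1 / \<tau> \<in> U \<Longrightarrow> f (- 1 / \<tau>) = c * f \<tau>"
  shows "c = - 1"
proof -
  define e where "e = deriv g \<i>"
  have "(g has_field_derivative e) (at \<i>)"
    unfolding e_def by (rule holomorphic_derivI[OF g(1) open_halfspace_Im_gt]) simp
  then have ge: "(\<lambda>w. g w / (w - \<i>)) \<midarrow>\<i>\<rightarrow> e"
    using g(2) by (simp add: has_field_derivative_iff)
  have e0: "e \<noteq> 0" using g(3) by (auto simp: e_def)
  have "\<forall>\<^sub>F w in at \<i>. g w / (w - \<i>) \<noteq> 0" using tendsto_imp_eventually_ne[OF ge e0] .
  \<comment> \<open>The simple zero of \<open>g\<close> at \<i> is isolated, so f = g f' does not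
    vanish nearby; this is what makes the order of \<open>f\<close> at \<i> well defined.\<close>
  then have ev0: "\<forall>\<^sub>F w in at \<i>. f w \<noteq> 0"
    using evU by eventually_elim (use fg in force)
  define n where "n = zorder f \<i>"
  define \<phi> where "\<phi> = zor_poly f \<i>"
  obtain r where r: "r > 0" "\<phi> holomorphic_on cball \<i> r" "\<phi> \<i> \<noteq> 0"
    "\<And>w. w \<in> cball \<i> r - {\<i>} \<Longrightarrow> f w = \<phi> w * (w - \<i>) powi n"
    using zorder_exist[of f \<i>] f eventually_frequently[OF at_neq_bot ev0]
    unfolding n_def \<phi>_def meromorphic_at_iff by blast
  have \<phi>: "\<phi> holomorphic_on ball \<i> r" using r(2) by (rule holomorphic_on_subset) auto
  have cont: "isCont \<phi> \<i>" "isCont (deriv \<phi>) \<i>"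
    using holomorphic_isCont[OF \<phi>] holomorphic_isCont[OF holomorphic_deriv[OF \<phi>]] r(1) by auto
  have evB: "\<forall>\<^sub>F w in at \<i>. w \<in> ball \<i> r - {\<i>}" using r(1) by (intro eventually_at_in_open) auto
  have df: "deriv f w = (deriv \<phi> w * (w - \<i>) + of_int n * \<phi> w) * (w - \<i>) powi (n - 1)"
    if w: "w \<in> ball \<i> r - {\<i>}" for w
  proof (rule DERIV_imp_deriv)
    have d: "(\<phi> has_field_derivative deriv \<phi> w) (at w)" using w by (intro holomorphic_derivI[OF \<phi>]) auto
    have "((\<lambda>w. (w - \<i>) powi n) has_field_derivative of_int n * (w - \<i>) powi (n - 1) * 1) (at w)"
      by (rule DERIV_power_int) (use w in \<open>auto intro!: derivative_eq_intros\<close>)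
    from DERIV_mult[OF d this]
    have "((\<lambda>w. \<phi> w * (w - \<i>) powi n) has_field_derivative
        deriv \<phi> w * (w - \<i>) powi n + of_int n * (w - \<i>) powi (n - 1) * 1 * \<phi> w) (at w)" .
    moreover have "(w - \<i>) powi n = (w - \<i>) * (w - \<i>) powi (n - 1)"
      using w power_int_minus_mult[of "w - \<i>" n] by (simp add: mult.commute)
    ultimately have "((\<lambda>w. \<phi> w * (w - \<i>) powi n) has_field_derivative
        (deriv \<phi> w * (w - \<i>) + of_int n * \<phi> w) * (w - \<i>) powi (n - 1)) (at w)"
      by (simp add: algebra_simps)
    moreover have "\<forall>\<^sub>F y in nhds w. f y = \<phi> y * (y - \<i>) powi n"
    proof (rule eventually_mono)
      show "\<forall>\<^sub>F y in nhds w. y \<in> ball \<i> r - {\<i>}" using w by (intro eventually_nhds_in_open) auto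
    qed (use r(4) in auto)
    ultimately show "(f has_field_derivative
        (deriv \<phi> w * (w - \<i>) + of_int n * \<phi> w) * (w - \<i>) powi (n - 1)) (at w)"
      by (simp add: has_field_derivative_cong_ev[OF refl])
  qed
  have "\<phi> \<i> = e * (of_int n * \<phi> \<i>)"
  proof -
    \<comment> \<open>This is f = g f' after division by the common power of
      \<open>w - \<i>\<close>. Its limit at \<i> compares leading coefficients and gives e n = 1 for
      the order n.\<close>
    have ev: "\<forall>\<^sub>F w in at \<i>. \<phi> w = g w / (w - \<i>) * (deriv \<phi> w * (w - \<i>) + of_int n * \<phi> w)"
      using evB evU
    proof eventually_elim
      case (elim w)
      have t: "w - \<i> \<noteq> 0" using elim by auto
      have "\<phi> w * ((w - \<i>) * (w - \<i>) powi (n - 1)) = f w"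
        using r(4)[of w] elim t power_int_minus_mult[of "w - \<i>" n] by (simp add: mult.commute)
      also have "\<dots> = g w * ((deriv \<phi> w * (w - \<i>) + of_int n * \<phi> w) * (w - \<i>) powi (n - 1))"
        using fg(2)[of w] df[OF elim(1)] elim by simp
      finally have "(w - \<i>) powi (n - 1) * (\<phi> w * (w - \<i>)) =
          (w - \<i>) powi (n - 1) * (g w * (deriv \<phi> w * (w - \<i>) + of_int n * \<phi> w))"
        by (simp only: mult_ac)
      then have "\<phi> w * (w - \<i>) = g w * (deriv \<phi> w * (w - \<i>) + of_int n * \<phi> w)"
        using t by simp
      then show ?case using t by (simp add: field_simps)
    qed
    have "(\<lambda>w. g w / (w - \<i>) * (deriv \<phi> w * (w - \<i>) + of_int n * \<phi> w)) \<midarrow>\<i>\<rightarrow>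
        e * (deriv \<phi> \<i> * (\<i> - \<i>) + of_int n * \<phi> \<i>)"
      using cont by (intro tendsto_intros ge) (auto simp: isCont_def)
    then have "\<phi> \<midarrow>\<i>\<rightarrow> e * (deriv \<phi> \<i> * (\<i> - \<i>) + of_int n * \<phi> \<i>)"
      by (simp only: tendsto_cong[OF ev])
    from LIM_unique[OF isContD[OF cont(1)] this] show ?thesis by simp
  qed
  then have en: "e * of_int n = 1" using r(3) by (metis mult.assoc mult_cancel_right2)
  have "odd n"
  proof -
    have "of_int (n\<^sup>2) = (e * of_int n)\<^sup>2" using g(3) by (simp add: e_def power_mult_distrib)
    then have "of_int (n\<^sup>2) = (of_int 1 :: complex)" unfolding en by simp
    then have "n\<^sup>2 = 1" by (simp only: of_int_eq_iff)
    then show ?thesis by (metis even_power odd_one zero_less_numeral)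
  qed
  \<comment> \<open>Since -1/w - \<i> = (-\<i>/w)(w - \<i>), inversion changes the local factor
    \<open>(w - \<i>) powi n\<close> by \<open>(- \<i> / w) powi n\<close>. At the fixed point this
    is (-1)^n, which equals -1 because n is odd.\<close>
  have "(- \<i> / \<i>) powi n * \<phi> (- 1 / \<i>) = c * \<phi> \<i>"
  proof (rule eventually_eq_imp_eq[where F = "\<lambda>w. (- \<i> / w) powi n * \<phi> (- 1 / w)" and G = "\<lambda>w. c * \<phi> w"])
    have inv: "isCont (\<lambda>w. - 1 / w) \<i>" by (intro continuous_intros) auto
    have "isCont (\<lambda>w. \<phi> (- 1 / w)) \<i>"
      by (rule isCont_o2[OF inv]) (use cont(1) in simp)
    moreover have "isCont (\<lambda>w. (- \<i> / w) powi n) \<i>"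
      by (intro continuous_intros) auto
    ultimately show "isCont (\<lambda>w. (- \<i> / w) powi n * \<phi> (- 1 / w)) \<i>"
      by (rule continuous_mult[rotated])
    show "isCont (\<lambda>w. c * \<phi> w) \<i>" using cont by (intro continuous_intros)
    have "(\<lambda>w. - 1 / w) \<midarrow>\<i>\<rightarrow> \<i>" using isContD[OF inv] by simp
    then have "\<forall>\<^sub>F w in at \<i>. - 1 / w \<in> ball \<i> r"
      using r(1) by (intro topological_tendstoD) auto
    then show "\<forall>\<^sub>F w in at \<i>. (- \<i> / w) powi n * \<phi> (- 1 / w) = c * \<phi> w"
      using evB evU tendsto_imp_eventually_ne[OF tendsto_ident_at complex_i_not_zero]
    proof eventually_elim
      case (elim w)
      have ne: "- 1 / w \<noteq> \<i>"
      proof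
        assume "- 1 / w = \<i>"
        then have "- 1 = \<i> * w" using elim by (simp add: field_simps)
        then have "w = \<i>" by (simp add: complex_eq_iff)
        then show False using elim by simp
      qed
      have eq: "- 1 / w - \<i> = (- \<i> / w) * (w - \<i>)" using elim by (simp add: field_simps)
      have "f w = \<phi> w * (w - \<i>) powi n"
        using elim by (intro r(4)) auto
      moreover have "f (- 1 / w) = \<phi> (- 1 / w) * ((- \<i> / w) powi n * (w - \<i>) powi n)"
        unfolding power_int_mult_distrib[symmetric] eq[symmetric]
        using elim ne by (intro r(4)) auto
      ultimately have "((- \<i> / w) powi n * \<phi> (- 1 / w)) * (w - \<i>) powi n = (c * \<phi> w) * (w - \<i>) powi n"
        using c[of w] elim by (simp add: mult_ac)
      moreover have "(w - \<i>) powi n \<noteq> 0" using elim by auto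
      ultimately show ?case using mult_right_cancel by blast
    qed
  qed
  then have "- 1 * \<phi> \<i> = c * \<phi> \<i>" using \<open>odd n\<close> by simp
  then have "- 1 = c" by (rule mult_right_cancel[OF r(3), THEN iffD1])
  then show ?thesis by (rule sym)
qed

section \<open>Growth of g at the cusp\<close>

text \<open>Differentiating the quadratic equation gives the linear equation g''' + 2 S g' + S' g =
  0. In the unknowns g, g' and k = g'' + S g it becomes a system that involves S but not S', so a
  bound on S suffices for \<open>linear_system_growth\<close>.\<close>

lemma growth_from_product_equation:
  assumes g: "g holomorphic_on {\<tau>. Im \<tau> > 0}" and S: "S holomorphic_on {\<tau>. Im \<tau> > 0}"
    and eq: "\<And>\<tau>. Im \<tau> > 0 \<Longrightarrow>
       2 * g \<tau> * deriv (deriv g) \<tau> - (deriv g \<tau>)\<^sup>2 + 2 * S \<tau> * (g \<tau>)\<^sup>2 = - 1"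
    and T: "\<And>\<tau>. Im \<tau> > 0 \<Longrightarrow> g (\<tau> + 1) = g \<tau>"
    and B: "\<And>\<tau>. Im \<tau> \<ge> 1 \<Longrightarrow> norm (S \<tau>) \<le> B"
  shows "\<exists>A N. \<forall>\<tau>. Im \<tau> \<ge> 1 \<longrightarrow> norm (g \<tau>) \<le> A * exp (N * Im \<tau>)"
proof -
  let ?H = "{\<tau>. Im \<tau> > 0}"
  have H: "open ?H" by (rule open_halfspace_Im_gt)
  define g1 where "g1 = deriv g"
  define k where "k = (\<lambda>\<tau>. deriv g1 \<tau> + S \<tau> * g \<tau>)"
  have hol: "g1 holomorphic_on ?H" "k holomorphic_on ?H" unfolding g1_def k_def
    by (intro holomorphic_intros holomorphic_deriv g S H)+
  have dg: "(g has_field_derivative g1 \<tau>) (at \<tau>)" if "Im \<tau> > 0" for \<tau>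
    unfolding g1_def using that by (intro holomorphic_derivI[OF g H]) auto
  have dg1: "(g1 has_field_derivative k \<tau> - S \<tau> * g \<tau>) (at \<tau>)" if "Im \<tau> > 0" for \<tau>
    using holomorphic_derivI[OF hol(1) H, of \<tau>] that by (simp add: k_def)
  have eq': "2 * g \<tau> * k \<tau> - (g1 \<tau>)\<^sup>2 = - 1" if "Im \<tau> > 0" for \<tau>
    using eq[OF that] by (simp add: k_def g1_def power2_eq_square algebra_simps)
  \<comment> \<open>Differentiation yields only g (k' + S g') = 0. If the second factor were nonzero
    at \<tau>, then g would vanish near \<tau>, and so g = g' = 0 there would contradict the
    right-hand side -1.\<close>
  have dk': "deriv k \<tau> = - S \<tau> * g1 \<tau>" if \<tau>: "Im \<tau> > 0" for \<tau>
  proof (rule ccontr)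
    let ?R = "\<lambda>\<tau>. deriv k \<tau> + S \<tau> * g1 \<tau>"
    assume "deriv k \<tau> \<noteq> - S \<tau> * g1 \<tau>"
    then have R0: "?R \<tau> \<noteq> 0" by (simp add: add_eq_0_iff2)
    have gR: "g w * ?R w = 0" if w: "Im w > 0" for w
    proof -
      have "(k has_field_derivative deriv k w) (at w)"
        using w by (intro holomorphic_derivI[OF hol(2) H]) auto
      then have "((\<lambda>w. 2 * g w * k w - (g1 w)\<^sup>2) has_field_derivative
          2 * g1 w * k w + 2 * g w * deriv k w - 2 * g1 w * (k w - S w * g w)) (at w)"
        by (auto intro!: derivative_eq_intros dg dg1 w simp: algebra_simps)
      moreover have "\<forall>\<^sub>F w in nhds w. 2 * g w * k w - (g1 w)\<^sup>2 = - 1"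
        using eventually_nhds_in_open[OF H, of w] w by (auto elim!: eventually_mono intro: eq')
      ultimately have "((\<lambda>w. - 1) has_field_derivative
          2 * g1 w * k w + 2 * g w * deriv k w - 2 * g1 w * (k w - S w * g w)) (at w)"
        by (simp add: has_field_derivative_cong_ev[OF refl])
      then have "2 * g1 w * k w + 2 * g w * deriv k w - 2 * g1 w * (k w - S w * g w) = 0"
        by (rule DERIV_unique) (rule DERIV_const)
      then have "2 * (g w * ?R w) = 0" by (simp add: algebra_simps)
      then show ?thesis by simp
    qed
    have "?R holomorphic_on ?H" by (intro holomorphic_intros holomorphic_deriv hol S H)
    then have "isCont ?R \<tau>" using \<tau> H
      by (metis continuous_on_eq_continuous_at holomorphic_on_imp_continuous_on mem_Collect_eq)
    then have "(?R \<longlongrightarrow> ?R \<tau>) (nhds \<tau>)"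
      unfolding isCont_def by (rule tendsto_at_iff_tendsto_nhds[THEN iffD1])
    then have "\<forall>\<^sub>F w in nhds \<tau>. ?R w \<noteq> 0"
      using R0 by (rule tendsto_imp_eventually_ne)
    moreover have "\<forall>\<^sub>F w in nhds \<tau>. w \<in> ?H" using \<tau> by (intro eventually_nhds_in_open H) auto
    ultimately have g0: "\<forall>\<^sub>F w in nhds \<tau>. g w = 0"
      by eventually_elim (use gR in force)
    then have "g1 \<tau> = deriv (\<lambda>_. 0) \<tau>" unfolding g1_def by (intro deriv_cong_ev) auto
    moreover have "g \<tau> = 0" using g0 by (rule eventually_nhds_x_imp_x)
    ultimately show False using eq'[OF \<tau>] by simp
  qed
  have dk: "(k has_field_derivative - S \<tau> * g1 \<tau>) (at \<tau>)" if "Im \<tau> > 0" for \<tau>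
    using holomorphic_derivI[OF hol(2) H, of \<tau>] dk'[OF that] that by simp
  have B0: "B \<ge> 0" using order_trans[OF norm_ge_zero B[of \<i>]] by simp
  \<comment> \<open>The initial energies at height 1 are bounded on one period by compactness;
    periodicity of \<open>g\<close> handles the other vertical lines.\<close>
  define E where "E = (\<lambda>x. (norm (g (Complex x 1)))\<^sup>2 + (norm (g1 (Complex x 1)))\<^sup>2 + (norm (k (Complex x 1)))\<^sup>2)"
  have "continuous_on {0..1} E"
  proof -
    have C: "continuous_on {0..1::real} (\<lambda>x. f (Complex x 1))" if "f holomorphic_on ?H" for f
    proof (rule continuous_on_compose2[OF holomorphic_on_imp_continuous_on[OF that]])
      show "continuous_on {0..1::real} (\<lambda>x. Complex x 1)"
        unfolding Complex_eq by (intro continuous_intros)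
    qed auto
    show ?thesis unfolding E_def by (intro continuous_intros C g hol)
  qed
  then have "compact (E ` {0..1})" by (rule compact_continuous_image) simp
  then obtain K where K: "\<And>x. x \<in> {0..1} \<Longrightarrow> norm (E x) \<le> K"
    by (meson compact_imp_bounded bounded_iff image_eqI)
  have K0: "K \<ge> 0" using order_trans[OF norm_ge_zero K[of 0]] by simp
  \<comment> \<open>The estimate is for the square of the norm, and K is at most (1 + K)^2; this
    avoids a square root.\<close>
  have bd: "norm (g (Complex x y)) \<le> (1 + K) * exp ((1 + B) * y)" if x: "x \<in> {0..1}" and y: "y \<ge> 1" for x y
  proof (rule power2_le_imp_le)
    have "(norm (g (Complex x y)))\<^sup>2 \<le> E x * exp (2 * (1 + B) * (y - 1))"
      unfolding E_def
      by (rule linear_system_growth[OF dg dg1 dk B y]) auto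
    also have "\<dots> \<le> (1 + K)\<^sup>2 * exp (2 * (1 + B) * y)"
    proof (intro mult_mono)
      have "E x \<le> K" using K[OF x] by simp
      also have "K \<le> (1 + K)\<^sup>2" using K0 by (simp add: power2_eq_square algebra_simps)
      finally show "E x \<le> (1 + K)\<^sup>2" .
      show "exp (2 * (1 + B) * (y - 1)) \<le> exp (2 * (1 + B) * y)"
        using B0 by (simp add: algebra_simps)
    qed (use K0 in auto)
    also have "exp (2 * (1 + B) * y) = (exp ((1 + B) * y))\<^sup>2"
      by (simp flip: exp_of_nat_mult add: exp_double[symmetric] mult.assoc)
    finally show "(norm (g (Complex x y)))\<^sup>2 \<le> ((1 + K) * exp ((1 + B) * y))\<^sup>2"
      by (simp add: power_mult_distrib)
  qed (use K0 in auto)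
  have "norm (g \<tau>) \<le> (1 + K) * exp ((1 + B) * Im \<tau>)" if \<tau>: "Im \<tau> \<ge> 1" for \<tau>
  proof -
    have "g (\<tau> + of_int (- \<lfloor>Re \<tau>\<rfloor>)) = g \<tau>"
      using \<tau> by (intro periodic_upper_half_plane_int T) auto
    moreover have "\<tau> + of_int (- \<lfloor>Re \<tau>\<rfloor>) = Complex (frac (Re \<tau>)) (Im \<tau>)"
      by (simp add: complex_eq_iff frac_def)
    ultimately show ?thesis
      using bd[of "frac (Re \<tau>)" "Im \<tau>"] \<tau> frac_lt_1[of "Re \<tau>"] by (simp add: less_imp_le)
  qed
  then show ?thesis by blast
qed

section \<open>Contradiction in both cases at the cusp\<close>

theorem theorem8p2:
  fixes s :: complex
  shows "\<not> (\<exists>h \<rho>. schwarzian_solution s h \<and> associated_representation h \<rho> \<and>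
            reducible_representation \<rho> \<and> finite_index (kernel SL2Z PGL2C \<rho>) SL2Z)"
proof (intro notI, elim exE conjE)
  fix h \<rho>
  assume sol: "schwarzian_solution s h" and rep: "associated_representation h \<rho>"
    and red: "reducible_representation \<rho>" and fi: "finite_index (kernel SL2Z PGL2C \<rho>) SL2Z"
  let ?H = "{\<tau>. Im \<tau> > 0}"
  have H: "open ?H" by (rule open_halfspace_Im_gt)
  have hom: "\<rho> \<in> hom SL2Z PGL2C" using rep by (simp add: associated_representation_def)
  have "group_hom SL2Z PGL2C \<rho>"
    by (intro group_hom.intro group_hom_axioms.intro group_SL2Z group_PGL2C hom)
  then have "finite (\<rho> ` carrier SL2Z)"
    using fi unfolding finite_index_def by (intro group_hom.finite_image_finite_index_kernel) auto
  then obtain D \<alpha> where D: "invertible D"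
    and act: "\<And>\<gamma> p. \<gamma> \<in> carrier SL2Z \<Longrightarrow> lft D (pgl_act (\<rho> \<gamma>) p) = map_option (\<lambda>x. \<alpha> \<gamma> * x) (lft D p)"
    and \<alpha>0: "\<And>\<gamma>. \<gamma> \<in> carrier SL2Z \<Longrightarrow> \<alpha> \<gamma> \<noteq> 0"
    and \<alpha>m: "\<And>\<gamma> \<delta>. \<gamma> \<in> carrier SL2Z \<Longrightarrow> \<delta> \<in> carrier SL2Z \<Longrightarrow> \<alpha> (\<gamma> ** \<delta>) = \<alpha> \<gamma> * \<alpha> \<delta>"
    using finite_reducible_diagonal[OF hom red] by blast
  obtain g f U where g: "g holomorphic_on ?H"
    and eq: "\<And>\<tau>. \<tau> \<in> ?H \<Longrightarrow>
       2 * g \<tau> * deriv (deriv g) \<tau> - (deriv g \<tau>)\<^sup>2 + 2 * (s * E4 \<tau>) * (g \<tau>)\<^sup>2 = - 1"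
    and fm: "f meromorphic_on ?H" and f: "f holomorphic_on U" and U: "open U" "U \<subseteq> ?H"
    and evU: "\<And>\<tau>. \<tau> \<in> ?H \<Longrightarrow> \<forall>\<^sub>F w in at \<tau>. w \<in> U"
    and fh: "\<And>\<tau>. \<tau> \<in> U \<Longrightarrow> lft D (P1_value h \<tau>) = Some (f \<tau>)"
    and fg: "\<And>\<tau>. \<tau> \<in> U \<Longrightarrow> deriv f \<tau> \<noteq> 0" "\<And>\<tau>. \<tau> \<in> U \<Longrightarrow> f \<tau> = g \<tau> * deriv f \<tau>"
    by (rule schwarzian_solution_logarithmic_derivative[OF sol D, unfolded upper_half_plane_def]) blast
  define S T :: "int^2^2" where "S = vector [vector [0, - 1], vector [1, 0]]"
    and "T = vector [vector [1, 1], vector [0, 1]]"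
  have ST: "S \<in> carrier SL2Z" "T \<in> carrier SL2Z"
    by (simp_all add: S_def T_def SL2Z_def det_2)
  have ST_act: "sl2z_act S \<tau> = - 1 / \<tau>" "sl2z_act T \<tau> = \<tau> + 1" for \<tau>
    by (simp_all add: sl2z_act_def S_def T_def)
  have equiv: "f (sl2z_act \<gamma> \<tau>) = \<alpha> \<gamma> * f \<tau>"
    if "\<gamma> \<in> carrier SL2Z" "\<tau> \<in> U" "sl2z_act \<gamma> \<tau> \<in> U" for \<gamma> \<tau>
  proof -
    have "P1_value h (sl2z_act \<gamma> \<tau>) = pgl_act (\<rho> \<gamma>) (P1_value h \<tau>)"
      using rep that(1,2) U(2) unfolding associated_representation_def upper_half_plane_def by blast
    then have "Some (f (sl2z_act \<gamma> \<tau>)) = map_option (\<lambda>x. \<alpha> \<gamma> * x) (Some (f \<tau>))"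
      using act[OF that(1)] fh that(2,3) by metis
    then show ?thesis by simp
  qed
  have fT: "f (\<tau> + 1) = \<alpha> T * f \<tau>" if "\<tau> \<in> U" "\<tau> + 1 \<in> U" for \<tau>
    using equiv[OF ST(2) that(1)] that(2) by (simp add: ST_act)
  have fS: "f (- 1 / \<tau>) = \<alpha> S * f \<tau>" if "\<tau> \<in> U" "- 1 / \<tau> \<in> U" for \<tau>
    using equiv[OF ST(1) that(1)] that(2) by (simp add: ST_act)
  have gT: "\<forall>\<^sub>F w in at \<tau>. w \<in> U \<and> w + 1 \<in> U" "g (\<tau> + 1) = g \<tau>" if "Im \<tau> > 0" for \<tau>
  proof -
    have "((\<lambda>\<tau>. \<tau> + 1) has_field_derivative 1) (at \<tau>)" for \<tau> :: complex
      by (auto intro!: derivative_eq_intros)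
    note * = semi_invariant_imp_weight[OF H U evU g f fg this _ _ _ \<alpha>0[OF ST(2)] fT, of \<tau>]
    show "\<forall>\<^sub>F w in at \<tau>. w \<in> U \<and> w + 1 \<in> U"
      using that by (intro *(1)) (auto simp: inj_on_def)
    have "g (\<tau> + 1) = 1 * g \<tau>" using that by (intro *(2)) (auto simp: inj_on_def)
    then show "g (\<tau> + 1) = g \<tau>" by simp
  qed
  have gS: "\<forall>\<^sub>F w in at \<tau>. w \<in> U \<and> - 1 / w \<in> U" "g (- 1 / \<tau>) = g \<tau> / \<tau>\<^sup>2" if "Im \<tau> > 0" for \<tau>
  proof -
    have d: "((\<lambda>\<tau>. - 1 / \<tau>) has_field_derivative 1 / \<tau>\<^sup>2) (at \<tau>)" if "\<tau> \<in> ?H" for \<tau>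
      using that by (auto intro!: derivative_eq_intros simp: power2_eq_square)
    have im: "(\<lambda>\<tau>. - 1 / \<tau>) ` ?H \<subseteq> ?H"
      by (auto simp: Im_divide intro!: divide_pos_pos add_nonneg_pos)
    have inj: "inj_on (\<lambda>\<tau>. - 1 / \<tau>) ?H" by (auto simp: inj_on_def)
    have cont: "continuous_on ?H (\<lambda>\<tau>. 1 / \<tau>\<^sup>2)" by (intro continuous_intros) auto
    note * = semi_invariant_imp_weight[OF H U evU g f fg d im inj cont \<alpha>0[OF ST(1)] fS, of \<tau>]
    show "\<forall>\<^sub>F w in at \<tau>. w \<in> U \<and> - 1 / w \<in> U" using that by (intro *(1)) auto
    have "g (- 1 / \<tau>) = 1 / \<tau>\<^sup>2 * g \<tau>" using that by (intro *(2)) auto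
    then show "g (- 1 / \<tau>) = g \<tau> / \<tau>\<^sup>2" by simp
  qed
  obtain B where B: "\<And>\<tau>. Im \<tau> \<ge> 1 \<Longrightarrow> norm (E4 \<tau>) \<le> B" using E4_bounded by blast
  have S_hol: "(\<lambda>\<tau>. s * E4 \<tau>) holomorphic_on ?H"
    using holomorphic_on_E4 unfolding upper_half_plane_def by (intro holomorphic_intros)
  have eq': "2 * g \<tau> * deriv (deriv g) \<tau> - (deriv g \<tau>)\<^sup>2 + 2 * (s * E4 \<tau>) * (g \<tau>)\<^sup>2 = - 1"
    if "Im \<tau> > 0" for \<tau>
    using eq that by simp
  have S_bd: "norm (s * E4 \<tau>) \<le> norm s * B" if "Im \<tau> \<ge> 1" for \<tau>
    using B[OF that] by (simp add: norm_mult mult_left_mono)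
  obtain A N where "\<And>\<tau>. Im \<tau> \<ge> 1 \<Longrightarrow> norm (g \<tau>) \<le> A * exp (N * Im \<tau>)"
    using growth_from_product_equation[OF g S_hol eq' gT(2) S_bd] by blast
  then consider (bounded) C where "\<And>\<tau>. Im \<tau> \<ge> 1 \<Longrightarrow> norm (g \<tau>) \<le> C"
    | (pole) "\<And>\<epsilon>. \<epsilon> > 0 \<Longrightarrow> \<exists>Y\<ge>0. \<forall>\<tau>. Im \<tau> > Y \<longrightarrow> g \<tau> \<noteq> 0 \<and> norm (1 / g \<tau>) \<le> \<epsilon>"
    using cusp_dichotomy[OF g gT(2)] by blast
  then show False
  proof cases
    case bounded
    have g0: "g \<tau> = 0" if "\<tau> \<in> ?H" for \<tau>
      using weight_minus_2_bounded_imp_zero[OF g gT(2) gS(2) bounded] that by simp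
    \<comment> \<open>Once \<open>g\<close> vanishes identically, every term on the left of the
      quadratic equation is 0, against -1 on the right.\<close>
    have "deriv g \<i> = deriv (\<lambda>_. 0) \<i>"
      using eventually_nhds_in_open[OF H, of \<i>] g0 by (intro deriv_cong_ev) (auto elim: eventually_mono)
    then show False using eq[of \<i>] g0[of \<i>] by simp
  next
    case pole
    have "\<alpha> T = 1"
      by (rule translation_multiplier_eq_1[OF U(1) gT(1) g f fg fT pole])
    then have "\<alpha> S = 1" using character_S_T[OF \<alpha>0 \<alpha>m] by (simp add: S_def T_def)
    moreover have "\<alpha> S = - 1"
    proof (rule inversion_multiplier_eq_minus_1[OF gS(1) g _ _ _ fg fS])
      \<comment> \<open>\<i> is fixed by the inversion and its square is -1, so the transformation
        law reads g(\<i>) = -g(\<i>). The quadratic equation at \<i> then reduces to its derivative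
        term.\<close>
      show gi: "g \<i> = 0" using gS(2)[of \<i>] by simp
      show "(deriv g \<i>)\<^sup>2 = 1" using eq[of \<i>] gi by simp
      show "f meromorphic_on {\<i>}" using fm by (rule meromorphic_on_subset) simp
    qed simp_all
    ultimately show False by simp
  qed
qed

end
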